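(* Let $F$ be an arbitrary quasinorm on $D(e)=\mathrm{span}(X,Y)\cong\mathbb{R}^2$. Let $(x,y,z,v,w)(t)$, $t\in\mathbb{R}$, be an extremal (with $M=1$) on the Cartan group with $x(0)=y(0)=z(0)=v(0)=w(0)=0$ such that $\varphi_4=\varphi_5=0$, $\varphi_3\neq0$. Then the functions $\theta(t)$ (considered modulo $2\pi$), $h(t)=(h_1(t),h_2(t))$, $x(t)$, $y(t)$ are periodic with joint period $L=2S_0/|\varphi_3|$, where $S_0$ is the area of the figure $U^*$. The projection $(x,y)(t)$ of the extremal onto the Minkowski plane $z=v=w=0$ with the quasinorm $F$ has the form $$x(t)=\frac{h_2(t)-\varphi_2}{\varphi_3},\qquad y(t)=-\frac{h_1(t)-\varphi_1}{\varphi_3},$$ and it is a periodic curve, parametrized by arc length, on an isoperimetrix. In addition, $h_1=r(\theta(t))\cos\theta(t)$, $h_2=r(\theta(t))\sin\theta(t)$, where $\theta=\theta(t)$ is the inverse function to $t(\theta)=\int_{\theta_0}^{\theta}\frac{r^2(\xi)}{\varphi_3}d\xi$, $\theta_0=\theta(0)$, and $$z(t)=\frac{t-\varphi_1x(t)-\varphi_2y(t)}{2\varphi_3}$$ is equal to the oriented area on the Euclidean plane with Cartesian coordinates $x,y$ traced by the rectilinear segment connecting the origin with the point $(x(\tau),y(\tau))$, $\tau\in[0,t]$. The functions $v(t),w(t)$ are given by $$v(t)=\frac1{12}x^2(t)y(t)-\frac12x(t)\int_0^tx\dot y\,d\tau+\frac12\int_0^tx^2\dot y\,d\tau,\qquad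 w(t)=-\frac1{12}x(t)y^2(t)-\frac12y(t)\int_0^tx\dot y\,d\tau+\int_0^txy\dot y\,d\tau,$$ or, equivalently, by $$v(t)=\frac13\int_0^t(x\dot z-z\dot x)d\tau-\frac16x(t)z(t),\qquad w(t)=\frac13\int_0^t(y\dot z-z\dot y)d\tau-\frac16y(t)z(t).$$
   Context: The Cartan algebra is the 5-dimensional real Lie algebra with basis $X,Y,Z,V,W$ and $[X,Y]=Z$, $[X,Z]=V$, $[Y,Z]=W$, all other brackets of basis elements zero. The Cartan group $G$ is the connected simply connected Lie group with this Lie algebra, identified with $\mathbb{R}^5$ via $(x,y,z,v,w)\leftrightarrow\exp(xX+yY+zZ+vV+wW)$ (the unit is $0$). A quasinorm $F:\mathbb{R}^2\to[0,\infty)$ satisfies $F(u)=0$ iff $u=0$, $F(\lambda u)=\lambda F(u)$ for $\lambda\ge0$, $F(u+u')\le F(u)+F(u')$ (symmetry is not required); $u_1X+u_2Y$ is identified with $(u_1,u_2)$, and $U=\{u: F(u)\le1\}$. Trajectories are the absolutely continuous solutions of $\dot g=u_1X(g)+u_2Y(g)$ with measurable controls $u(t)=(u_1(t),u_2(t))\in U$; in coordinates $$\dot x=u_1,\quad \dot y=u_2,\quad \dot z=\tfrac12(xu_2-yu_1),$$ $$\dot v=-\tfrac12\left(z+\tfrac16xy\right)u_1+\tfrac1{12}x^2u_2,\quad \dot w=-\tfrac1{12}y^2u_1-\tfrac12\left(z-\tfrac16xy\right)u_2 .$$ For a covector $\psi=(\psi_1,\dots,\psi_5)$ at $(x,y,z,v,w)$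 (components relative to $\partial_x,\partial_y,\partial_z,\partial_v,\partial_w$) put $$h_1=\psi(X)=\psi_1-\tfrac12\psi_3y-\tfrac1{12}\psi_4xy-\tfrac1{12}\psi_5y^2-\tfrac12\psi_4z,$$ $$h_2=\psi(Y)=\psi_2+\tfrac12\psi_3x+\tfrac1{12}\psi_4x^2+\tfrac1{12}\psi_5xy-\tfrac12\psi_5z,$$ and $\mathcal H=h_1u_1+h_2u_2$. An extremal with $M=1$ is a trajectory $g(t)=(x,y,z,v,w)(t)$, $t\in\mathbb{R}$, with control $u(t)$, for which there is an absolutely continuous nowhere vanishing $\psi(t)$ with $\dot\psi=-\partial\mathcal H/\partial(x,y,z,v,w)$ a.e. and, for a.e. $t$, $h_1(t)u_1(t)+h_2(t)u_2(t)=\max_{u\in U}(h_1(t)u_1+h_2(t)u_2)=1$. Put $\varphi_i=\psi_i(0)$, $i=1,\dots,5$. $F_U(h)=\max_{u\in U}h\cdot u$ is the support function of $U$ and $U^*=\{h: F_U(h)\le1\}$ the polar figure; $(h_1(t),h_2(t))$ lies on the curve $F_U=1$, whose polar equation is $r=r(\theta)$, $\theta\in\mathbb{R}$, and $\theta(t)$ is the continuous function with $h_1(t)=r(\theta(t))\cos\theta(t)$, $h_2(t)=r(\theta(t))\sin\theta(t)$. An isoperimetrix of the plane with quasinorm $F$ is here the boundary of a figure obtained from $\lambda U^*$, $\lambda>0$, by a rotation about the origin by the angle $\pi/2$ (in one of the two directions) followed by a translation; in the situation of the claim $\lambda=1/|\varphi_3|$ and the translation vector is $(-\varphi_2/\varphi_3,\varphi_1/\varphi_3)$.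 Parametrization by arc length means $F(\dot x,\dot y)=1$ a.e. *)

theory Defs
  imports "HOL-Analysis.Analysis" "HOL-Library.Real_Mod"
begin

section \<open>Quasinorms, polar figures, isoperimetrices\<close>

definition quasinorm :: "('a::real_vector \<Rightarrow> real) \<Rightarrow> bool" where
  "quasinorm F \<longleftrightarrow>
     (\<forall>p. 0 \<le> F p) \<and> (\<forall>p. F p = 0 \<longleftrightarrow> p = 0) \<and>
     (\<forall>c p. 0 \<le> c \<longrightarrow> F (c *\<^sub>R p) = c * F p) \<and> (\<forall>p q. F (p + q) \<le> F p + F q)"

definition unit_figure :: "(real \<times> real \<Rightarrow> real) \<Rightarrow> (real \<times> real) set" where
  "unit_figure F = {p. F p \<le> 1}"

text \<open>The supremum is a maximum when \<open>F\<close> is a quasinorm, since the unit figure is then compact.\<close>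

definition support_fun :: "(real \<times> real \<Rightarrow> real) \<Rightarrow> real \<times> real \<Rightarrow> real" where
  "support_fun F h = (SUP p\<in>unit_figure F. h \<bullet> p)"

definition polar_figure :: "(real \<times> real \<Rightarrow> real) \<Rightarrow> (real \<times> real) set" where
  "polar_figure F = {h. support_fun F h \<le> 1}"

text \<open>The polar equation \<open>r = polar_radius F \<theta>\<close> of the curve \<open>support_fun F h = 1\<close>.\<close>

definition polar_radius :: "(real \<times> real \<Rightarrow> real) \<Rightarrow> real \<Rightarrow> real" where
  "polar_radius F \<theta> = (THE r. r > 0 \<and> support_fun F (r * cos \<theta>, r * sin \<theta>) = 1)"

definition polar_angle :: "(real \<times> real \<Rightarrow> real) \<Rightarrow> (real \<Rightarrow> real) \<Rightarrow> (real \<Rightarrow> real) \<Rightarrow> (real \<Rightarrow> real) \<Rightarrow> bool" where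
  "polar_angle F h1 h2 \<theta> \<longleftrightarrow> continuous_on UNIV \<theta> \<and>
     (\<forall>t. h1 t = polar_radius F (\<theta> t) * cos (\<theta> t) \<and> h2 t = polar_radius F (\<theta> t) * sin (\<theta> t))"

definition rotation :: "real \<Rightarrow> real \<times> real \<Rightarrow> real \<times> real" where
  "rotation \<alpha> = (\<lambda>(a, b). (a * cos \<alpha> - b * sin \<alpha>, a * sin \<alpha> + b * cos \<alpha>))"

definition rotated_polar_boundary ::
    "(real \<times> real \<Rightarrow> real) \<Rightarrow> real \<Rightarrow> real \<Rightarrow> real \<times> real \<Rightarrow> (real \<times> real) set" where
  "rotated_polar_boundary F k \<alpha> c =
     frontier ((\<lambda>p. c + rotation \<alpha> (k *\<^sub>R p)) ` polar_figure F)"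

definition isoperimetrix :: "(real \<times> real \<Rightarrow> real) \<Rightarrow> (real \<times> real) set \<Rightarrow> bool" where
  "isoperimetrix F C \<longleftrightarrow>
     (\<exists>k>0. \<exists>\<alpha>\<in>{pi/2, -pi/2}. \<exists>c. C = rotated_polar_boundary F k \<alpha> c)"

section \<open>Oriented area\<close>

definition oriented_triangle_area :: "real \<times> real \<Rightarrow> real \<times> real \<Rightarrow> real" where
  "oriented_triangle_area P Q = (fst P * snd Q - snd P * fst Q) / 2"

text \<open>\<open>A\<close> is the oriented area swept by the segment from the origin to \<open>\<gamma> \<tau>\<close> while \<open>\<tau>\<close> runs from
  \<open>a\<close> to \<open>b\<close> (backwards if \<open>b < a\<close>): the limit, as the mesh of the partition tends to \<open>0\<close>, of the sums
  of the oriented areas of the triangles with vertices \<open>0\<close>, \<open>\<gamma> (p i)\<close>, \<open>\<gamma> (p (Suc i))\<close>.\<close>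

definition has_swept_area :: "(real \<Rightarrow> real \<times> real) \<Rightarrow> real \<Rightarrow> real \<Rightarrow> real \<Rightarrow> bool" where
  "has_swept_area \<gamma> a b A \<longleftrightarrow>
     (\<forall>\<epsilon>>0. \<exists>\<delta>>0. \<forall>n p.
        p 0 = a \<and> p n = b \<and>
        ((\<forall>i<n. p i \<le> p (Suc i)) \<or> (\<forall>i<n. p (Suc i) \<le> p i)) \<and>
        (\<forall>i<n. \<bar>p (Suc i) - p i\<bar> < \<delta>)
        \<longrightarrow> \<bar>(\<Sum>i<n. oriented_triangle_area (\<gamma> (p i)) (\<gamma> (p (Suc i)))) - A\<bar> < \<epsilon>)"

section \<open>Absolute continuity\<close>

definition abs_cont_on :: "real set \<Rightarrow> (real \<Rightarrow> 'a::metric_space) \<Rightarrow> bool" where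
  "abs_cont_on S f \<longleftrightarrow>
     (\<forall>\<epsilon>>0. \<exists>\<delta>>0. \<forall>(n::nat) a b.
        (\<forall>i<n. a i \<le> b i \<and> {a i..b i} \<subseteq> S) \<and>
        disjoint_family_on (\<lambda>i. {a i<..<b i}) {..<n} \<and>
        (\<Sum>i<n. b i - a i) < \<delta>
        \<longrightarrow> (\<Sum>i<n. dist (f (a i)) (f (b i))) < \<epsilon>)"

text \<open>On the whole line, absolute continuity means absolute continuity on every compact interval.\<close>

definition locally_abs_cont :: "(real \<Rightarrow> 'a::metric_space) \<Rightarrow> bool" where
  "locally_abs_cont f \<longleftrightarrow> (\<forall>a b. abs_cont_on {a..b} f)"

section \<open>Extremals on the Cartan group\<close>

text \<open>Points of the group are given by their exponential coordinates \<open>(x, y, z, v, w)\<close>, covectors by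
  their components relative to the coordinate fields; the pairing is then the inner product.\<close>

type_synonym real5 = "real \<times> real \<times> real \<times> real \<times> real"

text \<open>The left-invariant vector fields \<open>X\<close> and \<open>Y\<close> in these coordinates.\<close>

definition cartan_X :: "real5 \<Rightarrow> real5" where
  "cartan_X = (\<lambda>(x, y, z, v, w). (1, 0, - y / 2, - (z + x * y / 6) / 2, - (y^2) / 12))"

definition cartan_Y :: "real5 \<Rightarrow> real5" where
  "cartan_Y = (\<lambda>(x, y, z, v, w). (0, 1, x / 2, x^2 / 12, - (z - x * y / 6) / 2))"

definition trajectory ::
    "(real \<times> real \<Rightarrow> real) \<Rightarrow> (real \<Rightarrow> real5) \<Rightarrow> (real \<Rightarrow> real \<times> real) \<Rightarrow> bool" where
  "trajectory F g u \<longleftrightarrow>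
     u \<in> borel_measurable lebesgue \<and> (\<forall>t. u t \<in> unit_figure F) \<and> locally_abs_cont g \<and>
     (AE t in lebesgue.
        (g has_vector_derivative fst (u t) *\<^sub>R cartan_X (g t) + snd (u t) *\<^sub>R cartan_Y (g t)) (at t))"

definition ham1 :: "real5 \<Rightarrow> real5 \<Rightarrow> real" where
  "ham1 \<psi> q = \<psi> \<bullet> cartan_X q"

definition ham2 :: "real5 \<Rightarrow> real5 \<Rightarrow> real" where
  "ham2 \<psi> q = \<psi> \<bullet> cartan_Y q"

lemma ham1_coords:
  "ham1 (\<psi>1, \<psi>2, \<psi>3, \<psi>4, \<psi>5) (x, y, z, v, w) =
     \<psi>1 - 1/2 * \<psi>3 * y - 1/12 * \<psi>4 * x * y - 1/12 * \<psi>5 * y^2 - 1/2 * \<psi>4 * z"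
  by (simp add: ham1_def cartan_X_def field_simps)

lemma ham2_coords:
  "ham2 (\<psi>1, \<psi>2, \<psi>3, \<psi>4, \<psi>5) (x, y, z, v, w) =
     \<psi>2 + 1/2 * \<psi>3 * x + 1/12 * \<psi>4 * x^2 + 1/12 * \<psi>5 * x * y - 1/2 * \<psi>5 * z"
  by (simp add: ham2_def cartan_Y_def field_simps)

definition hamiltonian :: "real5 \<Rightarrow> real5 \<Rightarrow> real \<times> real \<Rightarrow> real" where
  "hamiltonian \<psi> q p = ham1 \<psi> q * fst p + ham2 \<psi> q * snd p"

text \<open>Extremals with \<open>M = 1\<close>. In the adjoint equation, \<open>D\<close> is the gradient of the Hamiltonian with
  respect to the point of the group.\<close>

definition extremal ::
    "(real \<times> real \<Rightarrow> real) \<Rightarrow> (real \<Rightarrow> real5) \<Rightarrow> (real \<Rightarrow> real \<times> real) \<Rightarrow> (real \<Rightarrow> real5) \<Rightarrow> bool" where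
  "extremal F g u \<psi> \<longleftrightarrow>
     trajectory F g u \<and> locally_abs_cont \<psi> \<and> (\<forall>t. \<psi> t \<noteq> 0) \<and>
     (AE t in lebesgue. \<exists>D. (GDERIV (\<lambda>q. hamiltonian (\<psi> t) q (u t)) (g t) :> D) \<and>
        (\<psi> has_vector_derivative - D) (at t)) \<and>
     (AE t in lebesgue.
        hamiltonian (\<psi> t) (g t) (u t) = support_fun F (ham1 (\<psi> t) (g t), ham2 (\<psi> t) (g t)) \<and>
        support_fun F (ham1 (\<psi> t) (g t), ham2 (\<psi> t) (g t)) = 1)"

end

theory Submission
  imports Defs
begin

text \<open>With \<open>\<phi>4 = \<phi>5 = 0\<close> the adjoint equation integrates to \<open>h = (\<phi>1 - \<phi>3 y, \<phi>2 + \<phi>3 x)\<close>, so the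
  projection \<open>(x, y)\<close> is, up to scaling by \<open>1 / \<bar>\<phi>3\<bar>\<close>, a quarter turn and a translation, the curve
  \<open>h\<close>, which stays on the boundary of the polar figure. Since \<open>h \<bullet> u = 1\<close>, the vector \<open>h\<close> sweeps area
  at the constant rate \<open>\<phi>3 / 2\<close>; hence \<open>r\<^sup>2 \<theta>' = \<phi>3\<close> and the period is the time needed to sweep the
  polar figure once. The formulas for \<open>z\<close>, \<open>v\<close>, \<open>w\<close> compare functions with the same derivative almost
  everywhere.\<close>

section \<open>The fundamental theorem of calculus for absolutely continuous functions\<close>

text \<open>The control is only measurable, so \<open>h\<close> is merely Lipschitz, and the polar
  figure may have corners, so \<open>polar_radius\<close> is merely continuous. The law for the
  angle therefore cannot be found by differentiating \<open>h\<close> in polar coordinates. What can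
  be differentiated at every time is the cross product of a fixed value \<open>h s\<close> with
  \<open>h t\<close>. It equals \<open>r s * r t * sin (\<theta> t - \<theta> s)\<close>, and
  continuity of \<open>r\<close> suffices to extract the derivative of \<theta> from it.

  A second obstacle lies in comparing functions whose derivatives agree almost everywhere: without
  absolute continuity this fails, as the Cantor function shows. Hence a fundamental theorem for
  absolutely continuous functions is proved. Because the controls are bounded, everything along an
  extremal is even locally Lipschitz, and this class is stable under products.

  The constant \<open>2 * S0\<close> is the increment over one turn of an antiderivative
  \<open>R\<close> of the squared polar radius. Since \<open>R (\<theta> t)\<close> is affine in
  \<open>t\<close> with slope \<phi>3, the same \<open>R\<close> gives the period and, after
  normalization, the inverse function of \<theta>.\<close>

lemma abs_cont_on_tagged:
  fixes f :: "real \<Rightarrow> real"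
  assumes f: "abs_cont_on {a..b} f" and e: "\<epsilon> > 0"
  obtains \<delta> where "\<delta> > 0"
    "\<And>p. p tagged_partial_division_of {a..b} \<Longrightarrow> (\<Sum>(x,K)\<in>p. measure lborel K) < \<delta> \<Longrightarrow>
       (\<Sum>(x,K)\<in>p. \<bar>f (Sup K) - f (Inf K)\<bar>) < \<epsilon>"
proof -
  obtain \<delta> where \<delta>: "\<delta> > 0"
    and ac: "\<And>(n::nat) A B. (\<forall>i<n. A i \<le> B i \<and> {A i..B i} \<subseteq> {a..b}) \<and>
        disjoint_family_on (\<lambda>i. {A i<..<B i}) {..<n} \<and> (\<Sum>i<n. B i - A i) < \<delta>
        \<longrightarrow> (\<Sum>i<n. dist (f (A i)) (f (B i))) < \<epsilon>"
    using f e unfolding abs_cont_on_def by meson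
  have "(\<Sum>(x,K)\<in>p. \<bar>f (Sup K) - f (Inf K)\<bar>) < \<epsilon>"
    if p: "p tagged_partial_division_of {a..b}" and lt: "(\<Sum>(x,K)\<in>p. measure lborel K) < \<delta>" for p
  proof -
    note pD = tagged_partial_division_ofD[OF p]
    obtain h where h: "bij_betw h {..<card p} p"
      using ex_bij_betw_nat_finite[OF pD(1)] by (auto simp: atLeast0LessThan)
    have K: "snd k = {Inf (snd k)..Sup (snd k)} \<and> Inf (snd k) \<le> Sup (snd k)
        \<and> snd k \<subseteq> {a..b} \<and> measure lborel (snd k) = Sup (snd k) - Inf (snd k)" if "k \<in> p" for k
    proof -
      obtain s L where k: "k = (s, L)" by (cases k)
      with that pD(2,3) have sL: "s \<in> L" "L \<subseteq> {a..b}" by auto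
      obtain u' v' where "L = {u'..v'}"
        using pD(4) \<open>k \<in> p\<close> k by force
      then show ?thesis using sL k by auto
    qed
    have hp: "h i \<in> p" if "i < card p" for i
      using h that by (auto simp: bij_betw_def)
    \<comment> \<open>Cells of a division may share endpoints; only their interiors are disjoint,
      which is exactly what the open intervals in \<open>abs_cont_on\<close> ask for.\<close>
    have "disjoint_family_on (\<lambda>i. {Inf (snd (h i))<..<Sup (snd (h i))}) {..<card p}"
      unfolding disjoint_family_on_def
    proof (intro ballI impI)
      fix i j assume ij: "i \<in> {..<card p}" "j \<in> {..<card p}" "i \<noteq> j"
      then have "h i \<noteq> h j" using h by (auto simp: bij_betw_def inj_on_def)
      then have "interior (snd (h i)) \<inter> interior (snd (h j)) = {}"
        using pD(5)[of "fst (h i)" "snd (h i)" "fst (h j)" "snd (h j)"] hp ij by simp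
      moreover have "interior (snd (h i)) = {Inf (snd (h i))<..<Sup (snd (h i))}" if "i < card p" for i
        using K[OF hp[OF that]] interior_atLeastAtMost_real by metis
      ultimately show "{Inf (snd (h i))<..<Sup (snd (h i))} \<inter> {Inf (snd (h j))<..<Sup (snd (h j))} = {}"
        using ij by simp
    qed
    moreover have "(\<Sum>i<card p. Sup (snd (h i)) - Inf (snd (h i))) = (\<Sum>(x,K)\<in>p. measure lborel K)"
      unfolding case_prod_unfold using sum.reindex_bij_betw[OF h, of "\<lambda>k. measure lborel (snd k)"] K hp by simp
    ultimately have "(\<Sum>i<card p. dist (f (Inf (snd (h i)))) (f (Sup (snd (h i))))) < \<epsilon>"
      using ac[where A="\<lambda>i. Inf (snd (h i))" and B="\<lambda>i. Sup (snd (h i))" and n="card p"] K hp lt by auto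
    also have "(\<Sum>i<card p. dist (f (Inf (snd (h i)))) (f (Sup (snd (h i)))))
        = (\<Sum>(x,K)\<in>p. \<bar>f (Sup K) - f (Inf K)\<bar>)"
      unfolding case_prod_unfold
      using sum.reindex_bij_betw[OF h, of "\<lambda>k. \<bar>f (Sup (snd k)) - f (Inf (snd k))\<bar>"]
      by (simp add: dist_real_def abs_minus_commute)
    finally show ?thesis .
  qed
  with \<delta> show ?thesis using that by blast
qed

text \<open>Passing to interiors makes the cells disjoint without changing their lengths, so
  additivity and monotonicity of Lebesgue measure apply.\<close>

lemma tagged_partial_division_content_le:
  assumes p: "p tagged_partial_division_of {a..b::real}"
    and T: "T \<in> lmeasurable" "\<And>x K. (x, K) \<in> p \<Longrightarrow> K \<subseteq> T"
  shows "(\<Sum>(x,K)\<in>p. measure lborel K) \<le> measure lebesgue T"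
proof -
  note pD = tagged_partial_division_ofD[OF p]
  have K: "measure lborel K = measure lebesgue (interior K) \<and> interior K \<in> lmeasurable" if xK: "(x, K) \<in> p" for x K
  proof -
    obtain u v where "K = cbox u v" using pD(4)[OF xK] by blast
    then show ?thesis
      by (cases "u \<le> v") auto
  qed
  have "(\<Sum>(x,K)\<in>p. measure lborel K) = (\<Sum>k\<in>p. measure lebesgue (interior (snd k)))"
    unfolding case_prod_unfold using K by (intro sum.cong) (auto)
  also have "\<dots> = measure lebesgue (\<Union>k\<in>p. interior (snd k))"
  proof (rule measure_UNION'[symmetric])
    show "finite p" by (rule pD)
    show "pairwise (\<lambda>k l. disjnt (interior (snd k)) (interior (snd l))) p"
      unfolding pairwise_def disjnt_def using pD(5) by (metis prod.collapse)
  qed (use K in auto)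
  also have "\<dots> \<le> measure lebesgue T"
  proof (rule measure_mono_fmeasurable)
    show "(\<Union>k\<in>p. interior (snd k)) \<subseteq> T"
      using T(2) interior_subset by fastforce
    show "(\<Union>k\<in>p. interior (snd k)) \<in> sets lebesgue"
      using K pD(1) by (intro sets.finite_UN) auto
  qed (rule T)
  finally show ?thesis .
qed

text \<open>Gauge proof: a division interval tagged at a point of differentiability is handled as in the
  classical fundamental theorem; those tagged in the exceptional null set lie in an open set of
  small measure, so absolute continuity bounds their contribution.\<close>

theorem abs_cont_on_has_integral:
  fixes f f' :: "real \<Rightarrow> real"
  assumes ab: "a \<le> b" and f: "abs_cont_on {a..b} f"
    and der: "AE t in lebesgue. t \<in> {a..b} \<longrightarrow> (f has_real_derivative f' t) (at t)"
  shows "(f' has_integral f b - f a) {a..b}"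
proof -
  obtain N where N: "negligible N"
    and derN: "\<And>t. t \<in> {a..b} \<Longrightarrow> t \<notin> N \<Longrightarrow> (f has_real_derivative f' t) (at t)"
    using der unfolding eventually_ae_filter_negligible by blast
  \<comment> \<open>On \<open>N\<close> nothing is known about the values of \<open>f'\<close>;
    replacing them by 0 leaves only the increments of \<open>f\<close> for cells tagged
    there.\<close>
  define g where "g = (\<lambda>t. if t \<in> N then 0 else f' t)"
  have "(g has_integral f b - f a) {a..b}"
    unfolding has_integral_real
  proof (intro allI impI)
    fix e :: real assume e: "e > 0"
    \<comment> \<open>The \<open>+ 1\<close> keeps the divisor of \<open>c\<close> positive when
      \<open>a = b\<close>.\<close>
    define l where "l = b - a + 1"
    have l: "l > 0" using ab by (simp add: l_def)
    define c where "c = e / 3 / l"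
    have c0: "c > 0" "c * l = e / 3" using e l by (simp_all add: c_def)
    moreover have "c * (b - a) \<le> c * l"
      using c0(1) by (intro mult_left_mono) (auto simp: l_def)
    ultimately have c: "c > 0" "c * (b - a) < e / 2"
      using e by linarith+
    have e2: "e / 2 > 0" using e by simp
    obtain \<delta> where \<delta>: "\<delta> > 0" and small:
      "\<And>p. p tagged_partial_division_of {a..b} \<Longrightarrow> (\<Sum>(x,K)\<in>p. measure lborel K) < \<delta> \<Longrightarrow>
       (\<Sum>(x,K)\<in>p. \<bar>f (Sup K) - f (Inf K)\<bar>) < e / 2"
      by (rule abs_cont_on_tagged[OF f e2]) (rule that)
    have Nset: "N \<in> null_sets lebesgue" using N negligible_iff_null_sets by blast
    then obtain T where T: "open T" "N \<subseteq> T" "T - N \<in> lmeasurable" "emeasure lebesgue (T - N) < ennreal \<delta>"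
      using sets_lebesgue_outer_open[of N \<delta>] \<delta> by (auto simp: null_sets_def)
    have "T = (T - N) \<union> N" using T by auto
    then have Tm: "T \<in> lmeasurable"
      using T(3) Nset fmeasurable.Un[of "T - N" lebesgue N] by (metis fmeasurableI_null_sets)
    have "measure lebesgue T \<le> measure lebesgue (T - N)"
      by (metis measure_Diff_null_set Nset Tm fmeasurableD order_refl)
    also have "\<dots> < \<delta>"
      using T(3,4) \<delta> by (metis emeasure_eq_measure2 ennreal_less_iff measure_nonneg)
    finally have mT: "measure lebesgue T < \<delta>" .
    have "\<exists>d>0. (x \<in> N \<longrightarrow> ball x d \<subseteq> T) \<and> (x \<in> {a..b} - N \<longrightarrow>
         (\<forall>y. \<bar>y - x\<bar> < d \<longrightarrow> \<bar>f y - f x - (y - x) * f' x\<bar> \<le> c * \<bar>y - x\<bar>))" for x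
    proof (cases "x \<in> N")
      case True
      then show ?thesis using T by (meson DiffD2 open_contains_ball subsetD)
    next
      case False
      then show ?thesis
      proof (cases "x \<in> {a..b}")
        case True
        then have "(f has_derivative (*) (f' x)) (at x)"
          using derN[of x] False by (simp add: has_field_derivative_def)
        then obtain d where "d > 0"
            "\<forall>y. norm (y - x) < d \<longrightarrow> norm (f y - f x - f' x * (y - x)) \<le> c * norm (y - x)"
          unfolding has_derivative_at_alt using c(1) by blast
        then show ?thesis
          using False by (intro exI[of _ d]) (simp add: mult.commute)
      qed (use zero_less_one in blast)
    qed
    then obtain d where d: "\<And>x. d x > 0" "\<And>x. x \<in> N \<Longrightarrow> ball x (d x) \<subseteq> T"
      "\<And>x y. \<lbrakk>x \<in> {a..b}; x \<notin> N; \<bar>y - x\<bar> < d x\<rbrakk> \<Longrightarrow> \<bar>f y - f x - (y - x) * f' x\<bar> \<le> c * \<bar>y - x\<bar>"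
      by (metis DiffI)
    show "\<exists>\<gamma>. gauge \<gamma> \<and> (\<forall>p. p tagged_division_of {a..b} \<and> \<gamma> fine p \<longrightarrow>
        norm ((\<Sum>(x, k)\<in>p. measure lborel k *\<^sub>R g x) - (f b - f a)) < e)"
    proof (intro exI conjI allI impI; (elim conjE)?)
      show "gauge (\<lambda>x. ball x (d x))" using d(1) by (auto simp: gauge_def)
      fix p assume p: "p tagged_division_of {a..b}" and fine: "(\<lambda>x. ball x (d x)) fine p"
      note pD = tagged_division_ofD[OF p]
      have part: "p tagged_partial_division_of {a..b}"
        using p by (simp add: tagged_division_of_def)
      define q where "q = {k \<in> p. fst k \<in> N}"
      have q: "q \<subseteq> p" "finite q" using pD(1) by (auto simp: q_def)
      have qpart: "q tagged_partial_division_of {a..b}"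
        using tagged_partial_division_subset[OF part q(1)] .
      have "(\<Sum>(x,K)\<in>q. measure lborel K) \<le> measure lebesgue T"
        using tagged_partial_division_content_le[OF qpart Tm] fine d(2)
        by (fastforce simp: q_def fine_def)
      then have qsmall: "(\<Sum>(x,K)\<in>q. \<bar>f (Sup K) - f (Inf K)\<bar>) < e / 2"
        using small[OF qpart] mT by simp
      have K: "\<exists>u v. K = {u..v} \<and> u \<le> v \<and> x \<in> {u..v} \<and> {u..v} \<subseteq> {a..b} \<and> {u..v} \<subseteq> ball x (d x)"
        if xK: "(x, K) \<in> p" for x K
      proof -
        obtain u v where "K = {u..v}" using pD(4)[OF xK] by auto
        moreover have "x \<in> K" "K \<subseteq> {a..b}" "K \<subseteq> ball x (d x)"
          using pD(2,3)[OF xK] fine xK by (auto simp: fine_def)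
        ultimately show ?thesis by (metis atLeastAtMost_iff order_trans)
      qed
      have good: "\<bar>measure lborel K * g x - (f (Sup K) - f (Inf K))\<bar> \<le> c * measure lborel K"
        if xK: "(x, K) \<in> p - q" for x K
      proof -
        obtain u v where uv: "K = {u..v}" "u \<le> v" "x \<in> {u..v}" "{u..v} \<subseteq> {a..b}" "{u..v} \<subseteq> ball x (d x)"
          using K[of x K] xK by auto
        have x: "x \<in> {a..b}" "x \<notin> N" using uv xK by (auto simp: q_def)
        have "u \<in> ball x (d x)" "v \<in> ball x (d x)"
          using uv(2,5) by (meson atLeastAtMost_iff order_refl subsetD)+
        then have "\<bar>f u - f x - (u - x) * f' x\<bar> \<le> c * \<bar>u - x\<bar>" "\<bar>f v - f x - (v - x) * f' x\<bar> \<le> c * \<bar>v - x\<bar>"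
          by (auto intro!: d(3) x simp: dist_real_def abs_minus_commute)
        \<comment> \<open>The tag lies between \<open>u\<close> and \<open>v\<close>, so the two
          one-sided errors add up to at most \<open>c\<close> times the length of the cell.\<close>
        then have "\<bar>(v - u) * f' x - (f v - f u)\<bar> \<le> c * (x - u) + c * (v - x)"
          using uv(3) by (simp add: algebra_simps)
        then show ?thesis using uv x by (simp add: g_def algebra_simps)
      qed
      have bad: "\<bar>measure lborel K * g x - (f (Sup K) - f (Inf K))\<bar> = \<bar>f (Sup K) - f (Inf K)\<bar>"
        if "(x, K) \<in> q" for x K
        using that by (simp add: q_def g_def)
      have "(\<Sum>(x, k)\<in>p. measure lborel k *\<^sub>R g x) - (f b - f a)
          = (\<Sum>(x, k)\<in>p. measure lborel k *\<^sub>R g x) - (\<Sum>(x,K)\<in>p. f (Sup K) - f (Inf K))"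
        using additive_tagged_division_1[OF ab p, of f] by simp
      also have "\<dots> = (\<Sum>(x, K)\<in>p. measure lborel K * g x - (f (Sup K) - f (Inf K)))"
        by (simp add: sum_subtractf case_prod_unfold)
      finally have "\<bar>(\<Sum>(x, k)\<in>p. measure lborel k *\<^sub>R g x) - (f b - f a)\<bar>
          \<le> (\<Sum>(x, K)\<in>p. \<bar>measure lborel K * g x - (f (Sup K) - f (Inf K))\<bar>)"
        unfolding case_prod_unfold by simp
      also have "\<dots> = (\<Sum>(x, K)\<in>q. \<bar>measure lborel K * g x - (f (Sup K) - f (Inf K))\<bar>)
          + (\<Sum>(x, K)\<in>p - q. \<bar>measure lborel K * g x - (f (Sup K) - f (Inf K))\<bar>)"
        using sum.subset_diff[OF q(1) pD(1)] by (simp add: add.commute)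
      also have "\<dots> \<le> (\<Sum>(x, K)\<in>q. \<bar>f (Sup K) - f (Inf K)\<bar>) + (\<Sum>(x, K)\<in>p - q. c * measure lborel K)"
        using good bad by (intro add_mono sum_mono) (auto simp: case_prod_unfold)
      also have "(\<Sum>(x, K)\<in>p - q. c * measure lborel K) \<le> (\<Sum>(x, K)\<in>p. c * measure lborel K)"
        using pD(1) c(1) by (intro sum_mono2) auto
      also have "\<dots> = c * (b - a)"
        using additive_content_tagged_division[of p a b] p ab
        by (simp add: sum_distrib_left[symmetric] case_prod_unfold)
      finally show "norm ((\<Sum>(x, k)\<in>p. measure lborel k *\<^sub>R g x) - (f b - f a)) < e"
        using qsmall c(2) by simp
    qed
  qed
  then show ?thesis
    by (rule has_integral_spike[OF N, rotated]) (auto simp: g_def)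
qed

section \<open>Locally Lipschitz functions and derivatives almost everywhere\<close>

definition locally_lipschitz :: "(real \<Rightarrow> real) \<Rightarrow> bool" where
  "locally_lipschitz f \<longleftrightarrow> (\<forall>R. \<exists>K. K-lipschitz_on {-R..R} f)"

lemma locally_lipschitz_add:
  "locally_lipschitz f \<Longrightarrow> locally_lipschitz g \<Longrightarrow> locally_lipschitz (\<lambda>t. f t + g t)"
  unfolding locally_lipschitz_def by (metis lipschitz_on_add)

lemma locally_lipschitz_continuous:
  assumes "locally_lipschitz f" shows "continuous_on S f"
proof (rule continuous_at_imp_continuous_on, rule ballI)
  fix t :: real
  obtain K where "K-lipschitz_on {-(\<bar>t\<bar> + 1)..\<bar>t\<bar> + 1} f"
    using assms unfolding locally_lipschitz_def by blast
  then have "continuous_on {-(\<bar>t\<bar> + 1)..\<bar>t\<bar> + 1} f"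
    by (rule lipschitz_on_continuous_on)
  then show "isCont f t"
    by (rule continuous_on_interior) (auto simp: interior_atLeastAtMost_real)
qed

lemma continuous_on_Icc_bounded:
  fixes f :: "real \<Rightarrow> real"
  assumes "continuous_on UNIV f" obtains M where "M > 0" "\<And>t. t \<in> {a..b} \<Longrightarrow> \<bar>f t\<bar> \<le> M"
proof -
  have "compact (f ` {a..b})"
    by (meson assms compact_Icc compact_continuous_image continuous_on_subset subset_UNIV)
  then show ?thesis
    using that compact_imp_bounded bounded_pos[of "f ` {a..b}"] by auto
qed

text \<open>The Lipschitz constant of a product involves bounds of both factors; these exist on
  compact intervals, which is why the notion is local.\<close>

lemma locally_lipschitz_mult:
  assumes f: "locally_lipschitz f" and g: "locally_lipschitz g"
  shows "locally_lipschitz (\<lambda>t. f t * g t)"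
  unfolding locally_lipschitz_def
proof
  fix R
  obtain K L where KL: "K-lipschitz_on {-R..R} f" "L-lipschitz_on {-R..R} g"
    using f g unfolding locally_lipschitz_def by blast
  obtain M where M: "M > 0" "\<And>t. t \<in> {-R..R} \<Longrightarrow> \<bar>f t\<bar> \<le> M"
    by (rule continuous_on_Icc_bounded[OF locally_lipschitz_continuous[OF f]]) (rule that)
  obtain N where N: "N > 0" "\<And>t. t \<in> {-R..R} \<Longrightarrow> \<bar>g t\<bar> \<le> N"
    by (rule continuous_on_Icc_bounded[OF locally_lipschitz_continuous[OF g]]) (rule that)
  have nn: "K \<ge> 0" "L \<ge> 0" using KL lipschitz_on_nonneg by auto
  have "(N * K + M * L)-lipschitz_on {-R..R} (\<lambda>t. f t * g t)"
  proof (rule lipschitz_onI)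
    fix s t assume st: "s \<in> {-R..R}" "t \<in> {-R..R}"
    have "\<bar>f s * g s - f t * g t\<bar> = \<bar>g s * (f s - f t) + f t * (g s - g t)\<bar>"
      by (simp add: algebra_simps)
    also have "\<dots> \<le> \<bar>g s\<bar> * \<bar>f s - f t\<bar> + \<bar>f t\<bar> * \<bar>g s - g t\<bar>"
      by (metis abs_mult abs_triangle_ineq)
    also have "\<dots> \<le> N * (K * \<bar>s - t\<bar>) + M * (L * \<bar>s - t\<bar>)"
      using lipschitz_onD[OF KL(1) st, unfolded dist_real_def]
        lipschitz_onD[OF KL(2) st, unfolded dist_real_def] M(2)[OF st(2)] N(2)[OF st(1)] M(1) N(1)
      by (intro add_mono mult_mono) simp_all
    finally show "dist (f s * g s) (f t * g t) \<le> (N * K + M * L) * dist s t"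
      by (simp add: dist_real_def algebra_simps)
  qed (use M N nn in auto)
  then show "\<exists>K. K-lipschitz_on {-R..R} (\<lambda>t. f t * g t)" by blast
qed

lemma locally_lipschitz_imp_abs_cont:
  assumes f: "locally_lipschitz f" shows "locally_abs_cont f"
  unfolding locally_abs_cont_def abs_cont_on_def
proof (intro allI impI)
  fix a b \<epsilon> :: real assume \<epsilon>: "\<epsilon> > 0"
  define R where "R = \<bar>a\<bar> + \<bar>b\<bar>"
  obtain K where K: "K-lipschitz_on {-R..R} f"
    using f unfolding locally_lipschitz_def by blast
  then have K0: "K \<ge> 0" by (rule lipschitz_on_nonneg)
  \<comment> \<open>The \<open>+ 1\<close> in the denominator covers \<open>K = 0\<close>.\<close>
  have step: "(\<Sum>i<n. dist (f (A i)) (f (B i))) < \<epsilon>"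
    if h: "(\<forall>i<n. A i \<le> B i \<and> {A i..B i} \<subseteq> {a..b}) \<and>
        disjoint_family_on (\<lambda>i. {A i<..<B i}) {..<n} \<and> (\<Sum>i<n. B i - A i) < \<epsilon> / (K + 1)"
      for n :: nat and A B
  proof -
    have "(\<Sum>i<n. dist (f (A i)) (f (B i))) \<le> (\<Sum>i<n. K * (B i - A i))"
    proof (rule sum_mono)
      fix i assume "i \<in> {..<n}"
      then have i: "A i \<le> B i" "{A i..B i} \<subseteq> {a..b}" using h by auto
      then have "A i \<in> {-R..R}" "B i \<in> {-R..R}" by (auto simp: R_def)
      from lipschitz_onD[OF K this] show "dist (f (A i)) (f (B i)) \<le> K * (B i - A i)"
        using i by (simp add: dist_real_def)
    qed
    also have "\<dots> \<le> (K + 1) * (\<Sum>i<n. B i - A i)"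
      using h by (auto simp: sum_distrib_left intro!: sum_mono mult_right_mono)
    also have "\<dots> < \<epsilon>"
      using h K0 by (simp add: field_simps)
    finally show ?thesis .
  qed
  show "\<exists>\<delta>>0. \<forall>(n::nat) A B. (\<forall>i<n. A i \<le> B i \<and> {A i..B i} \<subseteq> {a..b}) \<and>
        disjoint_family_on (\<lambda>i. {A i<..<B i}) {..<n} \<and> (\<Sum>i<n. B i - A i) < \<delta> \<longrightarrow>
        (\<Sum>i<n. dist (f (A i)) (f (B i))) < \<epsilon>"
  proof (intro exI[of _ "\<epsilon> / (K + 1)"] conjI allI impI)
    show "\<epsilon> / (K + 1) > 0" using \<epsilon> K0 by simp
  qed (rule step)
qed

text \<open>A mean value inequality that tolerates exceptional null sets, obtained by integrating
  the derivative. Absolute continuity is essential: the Cantor function would violate it with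
  \<open>K = 0\<close>.\<close>

lemma abs_cont_increment_bound:
  fixes f f' :: "real \<Rightarrow> real"
  assumes f: "locally_abs_cont f" and ab: "a \<le> b" and K: "K \<ge> 0"
    and der: "AE t in lebesgue. (f has_real_derivative f' t) (at t)"
    and bd: "AE t in lebesgue. t \<in> {a..b} \<longrightarrow> \<bar>f' t\<bar> \<le> K"
  shows "\<bar>f b - f a\<bar> \<le> K * (b - a)"
proof -
  \<comment> \<open>The integral estimate wants a bound at every point, so the derivative is cut off
    where the bound fails.\<close>
  define g where "g t = (if \<bar>f' t\<bar> \<le> K then f' t else 0)" for t
  have "AE t in lebesgue. t \<in> {a..b} \<longrightarrow> (f has_real_derivative g t) (at t)"
    using der bd by eventually_elim (auto simp: g_def)
  then have "(g has_integral f b - f a) (cbox a b)"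
    using abs_cont_on_has_integral[OF ab] f unfolding locally_abs_cont_def by simp
  then have "norm (f b - f a) \<le> K * measure lborel (cbox a b)"
    by (rule has_integral_bound[OF K]) (auto simp: g_def K)
  then show ?thesis using ab by simp
qed

text \<open>\<open>f\<close> is an antiderivative of \<open>f'\<close> in the sense of Lebesgue, with \<open>f'\<close> locally essentially bounded.\<close>

definition has_ae_derivative :: "(real \<Rightarrow> real) \<Rightarrow> (real \<Rightarrow> real) \<Rightarrow> bool" where
  "has_ae_derivative f f' \<longleftrightarrow> locally_lipschitz f \<and>
     (AE t in lebesgue. (f has_real_derivative f' t) (at t))"

text \<open>The mean value inequality turns the essential bound of the derivative into a Lipschitz
  constant.\<close>

lemma has_ae_derivative_of_abs_cont:
  assumes f: "locally_abs_cont f"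
    and der: "AE t in lebesgue. (f has_real_derivative f' t) (at t)"
    and bd: "\<And>R. \<exists>K. AE t in lebesgue. t \<in> {-R..R} \<longrightarrow> \<bar>f' t\<bar> \<le> K"
  shows "has_ae_derivative f f'"
  unfolding has_ae_derivative_def locally_lipschitz_def
proof (intro conjI der allI)
  fix R
  obtain K where K: "AE t in lebesgue. t \<in> {-R..R} \<longrightarrow> \<bar>f' t\<bar> \<le> K"
    using bd by blast
  \<comment> \<open>For \<open>R \<le> 0\<close> the bound constrains only a null set, so
    \<open>K\<close> may be negative.\<close>
  have "\<bar>K\<bar>-lipschitz_on {-R..R} f"
  proof (rule lipschitz_on_leI)
    fix s t assume st: "s \<in> {-R..R}" "t \<in> {-R..R}" "s \<le> t"
    have "AE r in lebesgue. r \<in> {s..t} \<longrightarrow> \<bar>f' r\<bar> \<le> \<bar>K\<bar>"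
      using K by eventually_elim (use st in auto)
    from abs_cont_increment_bound[OF f st(3) _ der this]
    show "dist (f s) (f t) \<le> \<bar>K\<bar> * dist s t"
      using st(3) by (simp add: dist_real_def abs_minus_commute)
  qed simp
  then show "\<exists>K. K-lipschitz_on {-R..R} f" by blast
qed

lemma has_ae_derivative_cong:
  assumes "has_ae_derivative f f'" "AE t in lebesgue. f' t = g' t"
  shows "has_ae_derivative f g'"
proof -
  from assms have "AE t in lebesgue. (f has_real_derivative f' t) (at t)"
    by (simp add: has_ae_derivative_def)
  with assms(2) have "AE t in lebesgue. (f has_real_derivative g' t) (at t)"
    by eventually_elim simp
  with assms show ?thesis by (simp add: has_ae_derivative_def)
qed

lemma has_ae_derivative_C1:
  assumes der: "\<And>t. (f has_real_derivative f' t) (at t)" and cont: "continuous_on UNIV f'"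
  shows "has_ae_derivative f f'"
  unfolding has_ae_derivative_def locally_lipschitz_def
proof (intro conjI allI)
  fix R
  obtain M where M: "M > 0" "\<And>t. t \<in> {-R..R} \<Longrightarrow> \<bar>f' t\<bar> \<le> M"
    by (rule continuous_on_Icc_bounded[OF cont]) (rule that)
  have "M-lipschitz_on {-R..R} f"
  proof (rule lipschitz_onI)
    fix s t assume "s \<in> {-R..R}" "t \<in> {-R..R}"
    then show "dist (f s) (f t) \<le> M * dist s t"
      using field_differentiable_bound[of "{-R..R}" f f' M s t] der M
      by (auto simp: dist_real_def intro: DERIV_subset)
  qed (use M in simp)
  then show "\<exists>K. K-lipschitz_on {-R..R} f" by blast
qed (use der in simp)

lemma has_ae_derivative_const: "has_ae_derivative (\<lambda>t. c) (\<lambda>t. 0)"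
  by (rule has_ae_derivative_C1) auto

lemma has_ae_derivative_ident: "has_ae_derivative (\<lambda>t. t) (\<lambda>t. 1)"
  by (rule has_ae_derivative_C1) auto

lemma has_ae_derivative_add:
  assumes "has_ae_derivative f f'" "has_ae_derivative g g'"
  shows "has_ae_derivative (\<lambda>t. f t + g t) (\<lambda>t. f' t + g' t)"
proof -
  from assms have "AE t in lebesgue. (f has_real_derivative f' t) (at t)"
    "AE t in lebesgue. (g has_real_derivative g' t) (at t)"
    by (simp_all add: has_ae_derivative_def)
  then have "AE t in lebesgue. ((\<lambda>t. f t + g t) has_real_derivative f' t + g' t) (at t)"
    by eventually_elim (rule DERIV_add)
  with assms show ?thesis
    by (simp add: has_ae_derivative_def locally_lipschitz_add)
qed

lemma has_ae_derivative_mult: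
  assumes "has_ae_derivative f f'" "has_ae_derivative g g'"
  shows "has_ae_derivative (\<lambda>t. f t * g t) (\<lambda>t. f' t * g t + g' t * f t)"
proof -
  from assms have "AE t in lebesgue. (f has_real_derivative f' t) (at t)"
    "AE t in lebesgue. (g has_real_derivative g' t) (at t)"
    by (simp_all add: has_ae_derivative_def)
  then have "AE t in lebesgue. ((\<lambda>t. f t * g t) has_real_derivative f' t * g t + g' t * f t) (at t)"
    by eventually_elim (rule DERIV_mult)
  with assms show ?thesis
    by (simp add: has_ae_derivative_def locally_lipschitz_mult)
qed

lemma has_ae_derivative_cmult:
  "has_ae_derivative f f' \<Longrightarrow> has_ae_derivative (\<lambda>t. c * f t) (\<lambda>t. c * f' t)"
  using has_ae_derivative_mult[OF has_ae_derivative_const[of c]] by (simp add: mult.commute)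

lemma has_ae_derivative_diff:
  "has_ae_derivative f f' \<Longrightarrow> has_ae_derivative g g' \<Longrightarrow>
   has_ae_derivative (\<lambda>t. f t - g t) (\<lambda>t. f' t - g' t)"
  using has_ae_derivative_add[OF _ has_ae_derivative_cmult[of g g' "-1"]] by simp

text \<open>\<open>closed_segment\<close> treats both orders of \<open>s\<close> and
  \<open>t\<close> at once, as extremals also run through negative times.\<close>

lemma has_ae_derivative_increment_bound:
  assumes "has_ae_derivative f f'" "K \<ge> 0" "AE r in lebesgue. r \<in> closed_segment s t \<longrightarrow> \<bar>f' r\<bar> \<le> K"
  shows "\<bar>f t - f s\<bar> \<le> K * \<bar>t - s\<bar>"
proof -
  have f: "locally_abs_cont f" "AE t in lebesgue. (f has_real_derivative f' t) (at t)"
    using assms by (simp_all add: has_ae_derivative_def locally_lipschitz_imp_abs_cont)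
  show ?thesis
  proof (cases "s \<le> t")
    case True
    then show ?thesis
      using abs_cont_increment_bound[OF f(1) True assms(2) f(2)] assms(3) by (simp add: closed_segment_eq_real_ivl)
  next
    case False
    then show ?thesis
      using abs_cont_increment_bound[OF f(1) _ assms(2) f(2), of t s] assms(3)
      by (simp add: closed_segment_eq_real_ivl abs_minus_commute)
  qed
qed

text \<open>The increment bound with \<open>K = 0\<close>, applied to the difference. Closed
  formulas are verified this way: a candidate with the right derivative and the right value at 0 is
  the function sought.\<close>

lemma has_ae_derivative_unique:
  assumes "has_ae_derivative f f'" "has_ae_derivative g f'" "f 0 = g 0"
  shows "f t = g t"
  using has_ae_derivative_increment_bound[OF has_ae_derivative_diff[OF assms(1,2)], of 0 0 t] assms(3)
  by simp

lemma has_ae_derivative_imp_AE_deriv: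
  assumes "has_ae_derivative f f'"
  shows "AE t in lebesgue. f differentiable (at t) \<and> deriv f t = f' t"
proof -
  have "AE t in lebesgue. (f has_real_derivative f' t) (at t)"
    using assms by (simp add: has_ae_derivative_def)
  then show ?thesis
    by eventually_elim (auto simp: DERIV_imp_deriv real_differentiable_def)
qed

text \<open>The fundamental theorem gives only a gauge integral. Where it exists, the derivative is
  bounded by the Lipschitz constant, and this makes it absolutely integrable, so that the Lebesgue
  integral has the same value.\<close>

lemma has_ae_derivative_lebesgue_integral:
  assumes f: "has_ae_derivative f f'" and ab: "a \<le> b"
  shows "(LINT t:{a<..<b}|lebesgue. f' t) = f b - f a"
proof -
  define R where "R = \<bar>a\<bar> + \<bar>b\<bar>"
  obtain K where K: "K-lipschitz_on {-R..R} f"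
    using f unfolding has_ae_derivative_def locally_lipschitz_def by blast
  have K0: "K \<ge> 0" using K lipschitz_on_nonneg by blast
  obtain N where N: "negligible N" "{t. \<not> (f has_real_derivative f' t) (at t)} \<subseteq> N"
    using f unfolding has_ae_derivative_def eventually_ae_filter_negligible by blast
  define g where "g t = (if t \<in> N then 0 else f' t)" for t
  have bd: "\<bar>g t\<bar> \<le> K" if t: "t \<in> {a<..<b}" for t
  proof (cases "t \<in> N")
    case False
    then have der: "(f has_real_derivative f' t) (at t)" using N by blast
    \<comment> \<open>All difference quotients close to \<open>t\<close> are bounded by
      \<open>K\<close>, hence so is their limit.\<close>
    then have "((\<lambda>s. \<bar>(f s - f t) / (s - t)\<bar>) \<longlongrightarrow> \<bar>f' t\<bar>) (at t)"
      by (intro tendsto_intros) (simp add: has_field_derivative_iff)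
    moreover have "\<forall>\<^sub>F s in at t. \<bar>(f s - f t) / (s - t)\<bar> \<le> K"
    proof -
      have "\<forall>\<^sub>F s in at t. s \<in> {a<..<b}"
        using t by (intro eventually_at_in_open') auto
      then show ?thesis
      proof eventually_elim
        case (elim s)
        then have "s \<in> {-R..R}" "t \<in> {-R..R}" using t by (auto simp: R_def)
        from lipschitz_onD[OF K this] show ?case
          using K0 by (cases "s = t") (auto simp: dist_real_def field_simps abs_divide)
      qed
    qed
    ultimately have "\<bar>f' t\<bar> \<le> K"
      by (rule tendsto_upperbound) simp
    then show ?thesis by (simp add: g_def K0)
  qed (simp add: g_def K0)
  have "AE t in lebesgue. t \<in> {a..b} \<longrightarrow> (f has_real_derivative f' t) (at t)"
    using f unfolding has_ae_derivative_def by (auto elim: eventually_mono)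
  moreover have "abs_cont_on {a..b} f"
    using f unfolding has_ae_derivative_def
    by (meson locally_abs_cont_def locally_lipschitz_imp_abs_cont)
  ultimately have "(f' has_integral f b - f a) {a..b}"
    by (intro abs_cont_on_has_integral[OF ab]) auto
  then have f': "(f' has_integral f b - f a) {a<..<b}"
    by (simp add: has_integral_Icc_iff_Ioo)
  then have "(g has_integral f b - f a) {a<..<b}"
    by (rule has_integral_spike[OF N(1), rotated]) (auto simp: g_def)
  then have "g absolutely_integrable_on {a<..<b}"
    using bd by (intro absolutely_integrable_integrable_bound[where g="\<lambda>_. K"])
      (auto simp: integrable_on_Icc_iff_Ioo[symmetric] intro: has_integral_integrable)
  then have "f' absolutely_integrable_on {a<..<b}"
    by (rule absolutely_integrable_spike[OF _ N(1)]) (auto simp: g_def)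
  then show ?thesis
    using f' by (simp add: set_lebesgue_integral_eq_integral integral_unique)
qed

lemma interval_integral_ae_derivative:
  assumes "has_ae_derivative f f'"
  shows "(LINT t=ereal a..ereal b|lebesgue. f' t) = f b - f a"
  using has_ae_derivative_lebesgue_integral[OF assms]
  by (simp add: interval_lebesgue_integral_def)

lemma interval_integral_ae_derivative_cong:
  assumes "has_ae_derivative f f'" "AE t in lebesgue. f' t = g t"
  shows "(LINT t=ereal a..ereal b|lebesgue. g t) = f b - f a"
  using interval_integral_ae_derivative[OF has_ae_derivative_cong[OF assms]] .

section \<open>Area in polar coordinates\<close>

lemma half_star_figure_borel:
  fixes H :: "real \<times> real \<Rightarrow> real"
  assumes "continuous_on UNIV H"
  shows "{p. \<sigma> * fst p > 0 \<and> H p \<le> 1} \<in> sets borel"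
proof -
  have "open {p :: real \<times> real. 0 < \<sigma> * fst p}"
    by (intro open_Collect_less continuous_intros)
  moreover have "closed {p. H p \<le> 1}"
    by (intro closed_Collect_le continuous_intros assms)
  ultimately show ?thesis
    using sets.Int[OF borel_open borel_closed] by (simp add: Collect_conj_eq)
qed

text \<open>The half plane where \<open>\<sigma> * a > 0\<close> is swept by the lines \<open>b = a * s\<close>; Fubini in the coordinates
  \<open>(a, s)\<close> followed by \<open>s = tan \<theta>\<close> replaces a two-dimensional change to polar coordinates.\<close>

lemma emeasure_half_star_figure:
  fixes H :: "real \<times> real \<Rightarrow> real"
  assumes cont: "continuous_on UNIV H"
    and hom: "\<And>c p. c > 0 \<Longrightarrow> H (c *\<^sub>R p) = c * H p"
    and pos: "\<And>p. p \<noteq> 0 \<Longrightarrow> H p > 0"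
    and \<sigma>: "\<sigma> \<in> {1, -1}"
  shows "emeasure lborel {p. \<sigma> * fst p > 0 \<and> H p \<le> 1} =
    ennreal (LBINT \<theta>=ereal (-(pi/2))..ereal (pi/2). 1 / (2 * (H (\<sigma> * cos \<theta>, \<sigma> * sin \<theta>))\<^sup>2))"
proof -
  define A where "A = {p. \<sigma> * fst p > 0 \<and> H p \<le> 1}"
  define k where "k = (\<lambda>s. H (\<sigma>, \<sigma> * s))"
  have \<sigma>0: "\<sigma> \<noteq> 0" "\<bar>\<sigma>\<bar> = 1" "\<sigma> * \<sigma> = 1" using \<sigma> by auto
  have "A \<in> sets borel"
    unfolding A_def by (rule half_star_figure_borel[OF cont])
  then have A [measurable]: "A \<in> sets (borel \<Otimes>\<^sub>M borel)"
    unfolding borel_prod .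
  have kcont: "continuous_on UNIV k"
    unfolding k_def by (intro continuous_on_compose2[OF cont] continuous_intros) auto
  have kpos: "k s > 0" for s unfolding k_def by (rule pos) (use \<sigma>0 in \<open>auto simp: zero_prod_def\<close>)
  have kcont': "isCont k s" for s using kcont by (simp add: continuous_on_eq_continuous_at)
  have km [measurable]: "k \<in> borel_measurable borel"
    using kcont by (rule borel_measurable_continuous_onI)
  have \<sigma>\<sigma>: "\<sigma> * (\<sigma> * x) = x" for x
    using \<sigma>0 by (simp flip: mult.assoc)
  \<comment> \<open>By homogeneity the ray of slope \<open>s\<close> leaves the figure at
    \<open>x = 1 / k s\<close>.\<close>
  have iA: "indicator A (\<sigma> * x, \<sigma> * x * s) = (indicator {0<..1 / k s} x :: ennreal)" for x s
  proof (cases "x > 0")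
    case True
    have "H (\<sigma> * x, \<sigma> * x * s) = x * k s"
      using hom[OF True, of "(\<sigma>, \<sigma> * s)"] by (simp add: k_def mult_ac)
    moreover have "x * k s \<le> 1 \<longleftrightarrow> x \<le> 1 / k s"
      using kpos[of s] by (simp add: pos_le_divide_eq)
    ultimately show ?thesis
      using True by (simp add: A_def indicator_def \<sigma>\<sigma>)
  next
    case False
    then show ?thesis by (simp add: A_def indicator_def \<sigma>\<sigma>)
  qed
  have "emeasure lborel A = (\<integral>\<^sup>+p. indicator A p \<partial>(lborel \<Otimes>\<^sub>M lborel))"
    using \<open>A \<in> sets borel\<close> by (simp add: lborel_prod)
  also have "\<dots> = (\<integral>\<^sup>+x. \<integral>\<^sup>+y. indicator A (x, y) \<partial>lborel \<partial>lborel)"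
    by (rule lborel.nn_integral_fst[symmetric]) measurable
  also have "\<dots> = (\<integral>\<^sup>+x. \<integral>\<^sup>+y. indicator A (\<sigma> * x, y) \<partial>lborel \<partial>lborel)"
    using \<sigma>0 by (subst nn_integral_real_affine[where c=\<sigma> and t=0]) auto
  also have "\<dots> = (\<integral>\<^sup>+x. \<integral>\<^sup>+s. ennreal x * indicator {0<..1 / k s} x \<partial>lborel \<partial>lborel)"
  proof (rule nn_integral_cong)
    fix x :: real
    show "(\<integral>\<^sup>+y. indicator A (\<sigma> * x, y) \<partial>lborel) = (\<integral>\<^sup>+s. ennreal x * indicator {0<..1 / k s} x \<partial>lborel)"
    proof (cases "x > 0")
      case True
      \<comment> \<open>For fixed \<open>x\<close> the substitution
        \<open>y = \<sigma> * x * s\<close> has Jacobian \<open>x\<close>, the weight that will be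
        integrated over \<open>0 < x \<le> 1 / k s\<close>.\<close>
      then have "(\<integral>\<^sup>+y. indicator A (\<sigma> * x, y) \<partial>lborel)
          = ennreal \<bar>\<sigma> * x\<bar> * (\<integral>\<^sup>+s. indicator A (\<sigma> * x, 0 + \<sigma> * x * s) \<partial>lborel)"
        using \<sigma>0 by (intro nn_integral_real_affine) auto
      also have "\<dots> = ennreal x * (\<integral>\<^sup>+s. indicator {0<..1 / k s} x \<partial>lborel)"
        using True \<sigma>0 by (simp add: iA abs_mult)
      also have "\<dots> = (\<integral>\<^sup>+s. ennreal x * indicator {0<..1 / k s} x \<partial>lborel)"
        by (rule nn_integral_cmult[symmetric]) (simp add: indicator_def[abs_def] greaterThanAtMost_iff)
      finally show ?thesis .
    next
      case False
      then have "indicator A (\<sigma> * x, y) = (0::ennreal)" for y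
        by (simp add: A_def indicator_def \<sigma>\<sigma>)
      then show ?thesis using False by simp
    qed
  qed
  also have "\<dots> = (\<integral>\<^sup>+s. \<integral>\<^sup>+x. ennreal x * indicator {0<..1 / k s} x \<partial>lborel \<partial>lborel)"
    by (rule lborel_pair.Fubini'[symmetric]) (simp add: indicator_def[abs_def] greaterThanAtMost_iff case_prod_unfold)
  also have "\<dots> = (\<integral>\<^sup>+s. ennreal (1 / (2 * (k s)\<^sup>2)) \<partial>lborel)"
  proof (rule nn_integral_cong)
    fix s :: real
    have "(\<integral>\<^sup>+x. ennreal x * indicator {0<..1 / k s} x \<partial>lborel) = (\<integral>\<^sup>+x. ennreal x * indicator {0..1 / k s} x \<partial>lborel)"
      by (intro nn_integral_cong) (auto simp: indicator_def)
    also have "\<dots> = ennreal ((1 / k s)\<^sup>2 / 2 - 0\<^sup>2 / 2)"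
      using kpos[of s] by (intro nn_integral_FTC_Icc) (auto intro!: derivative_eq_intros)
    finally show "(\<integral>\<^sup>+x. ennreal x * indicator {0<..1 / k s} x \<partial>lborel) = ennreal (1 / (2 * (k s)\<^sup>2))"
      by (simp add: power_divide)
  qed
  finally have 1: "emeasure lborel A = (\<integral>\<^sup>+s. ennreal (1 / (2 * (k s)\<^sup>2)) \<partial>lborel)" .
  let ?f = "\<lambda>s. 1 / (2 * (k s)\<^sup>2)" and ?g = "\<lambda>\<theta>. 1 / (2 * (H (\<sigma> * cos \<theta>, \<sigma> * sin \<theta>))\<^sup>2)"
  \<comment> \<open>\<open>H\<close> has degree one, so the squared cosine split off from
    \<open>H\<close> squared cancels against the derivative of \<open>tan\<close>.\<close>
  have fg: "?f (tan \<theta>) * (inverse (cos \<theta>))\<^sup>2 = ?g \<theta>" if "\<theta> \<in> {-(pi/2)<..<pi/2}" for \<theta>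
  proof -
    have c: "cos \<theta> > 0" using that by (intro cos_gt_zero_pi) auto
    have "H (\<sigma> * cos \<theta>, \<sigma> * sin \<theta>) = cos \<theta> * k (tan \<theta>)"
      using hom[OF c, of "(\<sigma>, \<sigma> * tan \<theta>)"] c by (simp add: k_def tan_def mult_ac)
    then show ?thesis using c kpos[of "tan \<theta>"] by (simp add: field_simps power2_eq_square)
  qed
  have gcont: "continuous_on UNIV ?g"
  proof (intro continuous_intros continuous_on_compose2[OF cont])
    show "\<forall>\<theta>\<in>UNIV. 2 * (H (\<sigma> * cos \<theta>, \<sigma> * sin \<theta>))\<^sup>2 \<noteq> 0"
    proof
      fix \<theta> :: real
      have "(\<sigma> * cos \<theta>, \<sigma> * sin \<theta>) \<noteq> 0"
        using \<sigma>0 sin_zero_abs_cos_one by (force simp: zero_prod_def)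
      then show "2 * (H (\<sigma> * cos \<theta>, \<sigma> * sin \<theta>))\<^sup>2 \<noteq> 0" using pos by force
    qed
  qed auto
  \<comment> \<open>In the variable \<theta> the integrand is continuous up to the endpoints, hence
    integrable although \<open>tan\<close> is unbounded there; the substitution rule requires this
    integrability.\<close>
  have gint: "set_integrable lborel {-(pi/2)<..<pi/2} ?g"
    by (rule set_integrable_subset[of _ "{-(pi/2)..pi/2}"])
      (auto intro!: borel_integrable_atLeastAtMost' continuous_on_subset[OF gcont])
  have fgint: "set_integrable lborel (einterval (ereal (-(pi/2))) (ereal (pi/2)))
      (\<lambda>\<theta>. ?f (tan \<theta>) * (inverse (cos \<theta>))\<^sup>2)"
    unfolding einterval_eq by (rule iffD2[OF set_integrable_cong[OF refl refl fg] gint])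
  note substitution = interval_integral_substitution_nonneg[where f="?f" and g=tan and g'="\<lambda>\<theta>. (inverse (cos \<theta>))\<^sup>2"
      and a="ereal (-(pi/2))" and b="ereal (pi/2)" and A="-\<infinity>" and B="\<infinity>", OF _ _ _ _ _ _ _ _ fgint]
  have cosnz: "cos \<theta> \<noteq> 0" if "ereal (-(pi/2)) < ereal \<theta>" "ereal \<theta> < ereal (pi/2)" for \<theta>
    using cos_gt_zero_pi[of \<theta>] that by simp
  have dtan: "(tan has_real_derivative (inverse (cos \<theta>))\<^sup>2) (at \<theta>)" if "cos \<theta> \<noteq> 0" for \<theta> :: real
    using DERIV_tan[OF that] by (simp add: power_inverse)
  have kc: "isCont ?f s" for s
    using kpos[of s] kcont' by (intro continuous_intros) auto
  have ic: "isCont (\<lambda>\<theta>. (inverse (cos \<theta>))\<^sup>2) \<theta>" if "cos \<theta> \<noteq> 0" for \<theta> :: real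
    using that by (intro continuous_intros)
  have lim: "((ereal \<circ> tan \<circ> real_of_ereal) \<longlongrightarrow> -\<infinity>) (at_right (ereal (-(pi/2))))"
    "((ereal \<circ> tan \<circ> real_of_ereal) \<longlongrightarrow> \<infinity>) (at_left (ereal (pi/2)))"
    using filterlim_tan_at_right filterlim_tan_at_left by (simp_all add: ereal_tendsto_simps del: uminus_ereal.simps)
  have fint: "set_integrable lborel (einterval (-\<infinity>) \<infinity>) ?f"
    by (rule substitution) (use cosnz kc ic lim dtan in auto)
  have feq: "(LBINT s=-\<infinity>..\<infinity>. ?f s) = (LBINT \<theta>=ereal (-(pi/2))..ereal (pi/2). ?f (tan \<theta>) * (inverse (cos \<theta>))\<^sup>2)"
    by (rule substitution) (use cosnz kc ic lim dtan in auto)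
  have "integrable lborel ?f"
    using fint by (simp add: set_integrable_def)
  then have "emeasure lborel A = ennreal (LBINT s. ?f s)"
    unfolding 1 by (intro nn_integral_eq_integral) auto
  also have "(LBINT s. ?f s) = (LBINT s=-\<infinity>..\<infinity>. ?f s)"
    by (simp add: interval_lebesgue_integral_def set_lebesgue_integral_def)
  also have "\<dots> = (LBINT \<theta>=ereal (-(pi/2))..ereal (pi/2). ?g \<theta>)"
    unfolding feq by (rule interval_integral_cong) (use fg in auto)
  finally show ?thesis by (simp add: A_def)
qed

text \<open>The half planes right and left of the vertical axis correspond to the angles from -pi/2
  to pi/2 and from pi/2 to 3 pi/2, and the axis itself is a null set. An arbitrary antiderivative
  \<open>R\<close> is used so that the area appears as an increment.\<close>

theorem measure_star_figure_polar:
  fixes H :: "real \<times> real \<Rightarrow> real" and R :: "real \<Rightarrow> real"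
  assumes cont: "continuous_on UNIV H"
    and hom: "\<And>c p. c > 0 \<Longrightarrow> H (c *\<^sub>R p) = c * H p"
    and pos: "\<And>p. p \<noteq> 0 \<Longrightarrow> H p > 0"
    and R: "\<And>\<theta>. (R has_real_derivative 1 / (H (cos \<theta>, sin \<theta>))\<^sup>2) (at \<theta>)"
  shows "measure lebesgue {p. H p \<le> 1} = (R (3 * pi / 2) - R (- (pi / 2))) / 2"
proof -
  have sphere: "(c * cos \<theta>, c * sin \<theta>) \<noteq> 0" if "c \<noteq> 0" for c \<theta> :: real
    using that sin_zero_abs_cos_one by (force simp: zero_prod_def)
  have gcont: "continuous_on UNIV (\<lambda>\<theta>. 1 / (2 * (H (\<sigma> * cos \<theta>, \<sigma> * sin \<theta>))\<^sup>2))" if "\<sigma> \<noteq> 0" for \<sigma>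
  proof (intro continuous_intros continuous_on_compose2[OF cont] ballI)
    fix \<theta> :: real
    show "2 * (H (\<sigma> * cos \<theta>, \<sigma> * sin \<theta>))\<^sup>2 \<noteq> 0"
      using pos[OF sphere[OF that, of \<theta>]] by simp
  qed auto
  have I1: "(LBINT \<theta>=ereal (-(pi/2))..ereal (pi/2). 1 / (2 * (H (1 * cos \<theta>, 1 * sin \<theta>))\<^sup>2))
      = R (pi/2) / 2 - R (-(pi/2)) / 2"
  proof (rule interval_integral_FTC_finite)
    show "continuous_on {min (-(pi/2)) (pi/2)..max (-(pi/2)) (pi/2)}
        (\<lambda>\<theta>. 1 / (2 * (H (1 * cos \<theta>, 1 * sin \<theta>))\<^sup>2))"
      by (rule continuous_on_subset[OF gcont]) auto
    fix \<theta> :: real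
    have "((\<lambda>\<theta>. R \<theta> / 2) has_real_derivative 1 / (2 * (H (1 * cos \<theta>, 1 * sin \<theta>))\<^sup>2)) (at \<theta>)"
      using R[of \<theta>] by (auto intro!: derivative_eq_intros)
    then show "((\<lambda>\<theta>. R \<theta> / 2) has_vector_derivative 1 / (2 * (H (1 * cos \<theta>, 1 * sin \<theta>))\<^sup>2))
        (at \<theta> within {min (-(pi/2)) (pi/2)..max (-(pi/2)) (pi/2)})"
      by (simp add: has_real_derivative_iff_has_vector_derivative has_vector_derivative_at_within)
  qed
  have I2: "(LBINT \<theta>=ereal (-(pi/2))..ereal (pi/2). 1 / (2 * (H ((-1) * cos \<theta>, (-1) * sin \<theta>))\<^sup>2))
      = R (3*pi/2) / 2 - R (pi/2) / 2"
  proof -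
    have "(LBINT \<theta>=ereal (-(pi/2))..ereal (pi/2). 1 / (2 * (H ((-1) * cos \<theta>, (-1) * sin \<theta>))\<^sup>2))
      = R (pi/2 + pi) / 2 - R (-(pi/2) + pi) / 2"
    proof (rule interval_integral_FTC_finite)
      show "continuous_on {min (-(pi/2)) (pi/2)..max (-(pi/2)) (pi/2)}
          (\<lambda>\<theta>. 1 / (2 * (H ((-1) * cos \<theta>, (-1) * sin \<theta>))\<^sup>2))"
        by (rule continuous_on_subset[OF gcont]) auto
      fix \<theta> :: real
      \<comment> \<open>Shifting the angle by pi changes both signs, which is the case
        \<open>\<sigma> = -1\<close> of the half-plane formula.\<close>
      have "((\<lambda>\<theta>. R (\<theta> + pi)) has_real_derivative 1 / (H (cos (\<theta> + pi), sin (\<theta> + pi)))\<^sup>2) (at \<theta>)"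
        using R[of "\<theta> + pi"] by (simp add: DERIV_shift)
      then have "((\<lambda>\<theta>. R (\<theta> + pi) / 2) has_real_derivative 1 / (2 * (H ((-1) * cos \<theta>, (-1) * sin \<theta>))\<^sup>2)) (at \<theta>)"
        by (auto intro!: derivative_eq_intros)
      then show "((\<lambda>\<theta>. R (\<theta> + pi) / 2) has_vector_derivative 1 / (2 * (H ((-1) * cos \<theta>, (-1) * sin \<theta>))\<^sup>2))
          (at \<theta> within {min (-(pi/2)) (pi/2)..max (-(pi/2)) (pi/2)})"
        by (simp add: has_real_derivative_iff_has_vector_derivative has_vector_derivative_at_within)
    qed
    moreover have pi: "pi/2 + pi = 3*pi/2" "-(pi/2) + pi = pi/2" by simp_all
    ultimately show ?thesis by (simp only: pi)
  qed
  \<comment> \<open>\<open>ennreal\<close> sends negative reals to 0, so the increments of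
    \<open>R\<close> must be known to be nonnegative before the areas can be read as real
    numbers.\<close>
  have "mono R"
  proof (rule monoI)
    fix a b :: real assume "a \<le> b"
    then show "R a \<le> R b"
    proof (rule DERIV_nonneg_imp_nondecreasing)
      fix \<theta>
      show "\<exists>y. (R has_real_derivative y) (at \<theta>) \<and> 0 \<le> y"
        using R[of \<theta>] by (intro exI[of _ "1 / (H (cos \<theta>, sin \<theta>))\<^sup>2"]) simp
    qed
  qed
  define B where "B = (\<lambda>\<sigma>. {p. \<sigma> * fst p > 0 \<and> H p \<le> 1})"
  have Bm: "B \<sigma> \<in> sets borel" for \<sigma>
    unfolding B_def by (rule half_star_figure_borel[OF cont])
  have B: "emeasure lborel (B 1) = ennreal (R (pi/2) / 2 - R (-(pi/2)) / 2)"
     "emeasure lborel (B (-1)) = ennreal (R (3*pi/2) / 2 - R (pi/2) / 2)"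
    using emeasure_half_star_figure[OF cont hom pos, of 1, unfolded I1]
      emeasure_half_star_figure[OF cont hom pos, of "-1", unfolded I2]
    by (simp_all add: B_def)
  have "measure lborel (B 1 \<union> B (-1)) = measure lborel (B 1) + measure lborel (B (-1))"
  proof (rule measure_Union)
    show "B 1 \<inter> B (-1) = {}" by (auto simp: B_def)
  qed (simp_all add: B Bm)
  also have "\<dots> = (R (3 * pi / 2) - R (- (pi / 2))) / 2"
  proof -
    have "R (-(pi/2)) \<le> R (pi/2)" "R (pi/2) \<le> R (3*pi/2)"
      using pi_gt_zero by (auto intro!: monoD[OF \<open>mono R\<close>])
    then have "measure lborel (B 1) = R (pi/2) / 2 - R (-(pi/2)) / 2"
      "measure lborel (B (-1)) = R (3*pi/2) / 2 - R (pi/2) / 2"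
      using B by (simp_all add: measure_def)
    then show ?thesis by simp
  qed
  finally have 1: "measure lebesgue (B 1 \<union> B (-1)) = (R (3 * pi / 2) - R (- (pi / 2))) / 2"
    using Bm by simp
  have "negligible {p :: real \<times> real. (1, 0) \<bullet> p = 0}"
    by (rule negligible_hyperplane) (auto simp: zero_prod_def)
  moreover have "sym_diff (B 1 \<union> B (-1)) {p. H p \<le> 1} \<subseteq> {p. (1, 0) \<bullet> p = 0}"
  proof
    fix p assume "p \<in> sym_diff (B 1 \<union> B (-1)) {p. H p \<le> 1}"
    then have "\<not> 0 < fst p" "\<not> fst p < 0" by (auto simp: B_def)
    then show "p \<in> {p. (1, 0) \<bullet> p = 0}" by (simp add: inner_prod_def)
  qed
  ultimately have "negligible (sym_diff (B 1 \<union> B (-1)) {p. H p \<le> 1})"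
    by (rule negligible_subset)
  moreover have "B 1 \<in> lmeasurable" "B (-1) \<in> lmeasurable"
    by (simp_all add: fmeasurable_def Bm B sets_completionI_sets)
  then have "B 1 \<union> B (-1) \<in> lmeasurable"
    by (rule fmeasurable.Un)
  ultimately have "measure lebesgue {p. H p \<le> 1} = measure lebesgue (B 1 \<union> B (-1))"
    by (intro measure_negligible_symdiff) 
  then show ?thesis using 1 by simp
qed

section \<open>Quasinorms and polar figures\<close>

text \<open>For a non-symmetric \<open>F\<close> the triangle inequality bounds
  \<open>F p - F q\<close> through \<open>F (p - q)\<close> only; exchanging the two points supplies
  the other side.\<close>

lemma one_sided_lipschitz_continuous:
  fixes f :: "'a::metric_space \<Rightarrow> real"
  assumes "C \<ge> 0" and le: "\<And>p q. f p - f q \<le> C * dist p q"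
  shows "continuous_on UNIV f"
proof -
  have "\<bar>f p - f q\<bar> \<le> C * dist p q" for p q
    using le[of p q] le[of q p] by (simp add: abs_le_iff dist_commute)
  then have "C-lipschitz_on UNIV f"
    using assms(1) by (intro lipschitz_onI) (simp_all add: dist_real_def)
  then show ?thesis by (rule lipschitz_on_continuous_on)
qed

context
  fixes F :: "real \<times> real \<Rightarrow> real"
  assumes F: "quasinorm F"
begin

lemma quasinorm_simps:
  "0 \<le> F p" "F p = 0 \<longleftrightarrow> p = 0" "0 \<le> c \<Longrightarrow> F (c *\<^sub>R p) = c * F p" "F (p + q) \<le> F p + F q"
  using F unfolding quasinorm_def by blast+

lemma quasinorm_upper_bound:
  obtains C where "C > 0" "\<And>p. F p \<le> C * norm p"
proof
  \<comment> \<open>Four values are needed since \<open>F\<close> may differ on opposite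
    directions.\<close>
  let ?C = "F (1, 0) + F (-1, 0) + F (0, 1) + F (0, -1)"
  have nn: "F (1, 0) \<ge> 0" "F (-1, 0) \<ge> 0" "F (0, 1) \<ge> 0" "F (0, -1) \<ge> 0"
    by (rule quasinorm_simps)+
  have "F (1, 0) \<noteq> 0" by (simp add: quasinorm_simps zero_prod_def)
  with nn show "?C > 0" by linarith
  fix p :: "real \<times> real"
  obtain a b where p: "p = (a, b)" by (cases p)
  have ab: "\<bar>a\<bar> \<le> norm p" "\<bar>b\<bar> \<le> norm p"
    using norm_fst_le[of a b] norm_snd_le[of b a] by (simp_all add: p)
  have a: "F (a, 0) \<le> \<bar>a\<bar> * (F (1, 0) + F (-1, 0))"
    using quasinorm_simps(3)[of "\<bar>a\<bar>" "(if a \<ge> 0 then 1 else -1, 0)"] nn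
    by (auto simp: abs_if distrib_left intro: mult_nonneg_nonneg mult_nonpos_nonneg[OF less_imp_le] split: if_splits)
  have b: "F (0, b) \<le> \<bar>b\<bar> * (F (0, 1) + F (0, -1))"
    using quasinorm_simps(3)[of "\<bar>b\<bar>" "(0, if b \<ge> 0 then 1 else -1)"] nn
    by (auto simp: abs_if distrib_left intro: mult_nonneg_nonneg mult_nonpos_nonneg[OF less_imp_le] split: if_splits)
  have "F p \<le> F (a, 0) + F (0, b)"
    using quasinorm_simps(4)[of "(a, 0)" "(0, b)"] by (simp add: p)
  also have "\<dots> \<le> norm p * (F (1, 0) + F (-1, 0)) + norm p * (F (0, 1) + F (0, -1))"
  proof (rule add_mono)
    show "F (a, 0) \<le> norm p * (F (1, 0) + F (-1, 0))"
      using a mult_right_mono[OF ab(1), of "F (1, 0) + F (-1, 0)"] nn by linarith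
    show "F (0, b) \<le> norm p * (F (0, 1) + F (0, -1))"
      using b mult_right_mono[OF ab(2), of "F (0, 1) + F (0, -1)"] nn by linarith
  qed
  finally show "F p \<le> ?C * norm p" by (simp add: algebra_simps)
qed

lemma quasinorm_continuous: "continuous_on UNIV F"
proof -
  obtain C where C: "C > 0" "\<And>p. F p \<le> C * norm p" by (rule quasinorm_upper_bound) (rule that)
  have le: "F p - F q \<le> C * dist p q" for p q
    using quasinorm_simps(4)[of "p - q" q] C(2)[of "p - q"] by (simp add: dist_norm)
  show ?thesis by (rule one_sided_lipschitz_continuous[OF less_imp_le[OF C(1)] le])
qed

text \<open>The constant is the minimum of \<open>F\<close> on the Euclidean unit sphere, attained
  by compactness and positive by definiteness. It is what bounds the unit figure and hence the
  controls.\<close>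

lemma quasinorm_lower_bound:
  obtains c where "c > 0" "\<And>p. c * norm p \<le> F p"
proof -
  have "compact (sphere (0 :: real \<times> real) 1)" "sphere (0 :: real \<times> real) 1 \<noteq> {}"
    by auto
  from continuous_attains_inf[OF this continuous_on_subset[OF quasinorm_continuous subset_UNIV]]
  obtain p0 where p0: "p0 \<in> sphere 0 1" "\<And>p. p \<in> sphere 0 1 \<Longrightarrow> F p0 \<le> F p"
    by blast
  have "F p0 \<noteq> 0" using p0(1) quasinorm_simps(2) by auto
  then have "F p0 > 0" using quasinorm_simps(1)[of p0] by linarith
  moreover have "F p0 * norm p \<le> F p" for p
  proof (cases "p = 0")
    case False
    have "F p = norm p * F (p /\<^sub>R norm p)"
      using False quasinorm_simps(3)[of "norm p" "p /\<^sub>R norm p"] by simp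
    moreover have "F p0 \<le> F (p /\<^sub>R norm p)" using False by (intro p0) simp
    ultimately show ?thesis
      using mult_left_mono[of "F p0" "F (p /\<^sub>R norm p)" "norm p"] by (simp only: mult.commute[of "F p0"]) simp
  qed (simp add: quasinorm_simps)
  ultimately show ?thesis by (rule that)
qed

lemma unit_figure_bounded:
  obtains B where "B > 0" "\<And>p. p \<in> unit_figure F \<Longrightarrow> norm p \<le> B"
proof -
  obtain c where c: "c > 0" "\<And>p. c * norm p \<le> F p" by (rule quasinorm_lower_bound) (rule that)
  have "norm p \<le> 1 / c" if "p \<in> unit_figure F" for p
    using that c(1) c(2)[of p] by (simp add: unit_figure_def field_simps)
  with c(1) show ?thesis using that[of "1 / c"] by simp
qed

lemma support_fun_upper:
  assumes "p \<in> unit_figure F" shows "h \<bullet> p \<le> support_fun F h"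
proof -
  obtain B where B: "B > 0" "\<And>p. p \<in> unit_figure F \<Longrightarrow> norm p \<le> B"
    by (rule unit_figure_bounded) (rule that)
  have "bdd_above ((\<lambda>p. h \<bullet> p) ` unit_figure F)"
  proof (rule bdd_aboveI2)
    fix p assume "p \<in> unit_figure F"
    then show "h \<bullet> p \<le> norm h * B"
      using norm_cauchy_schwarz[of h p] mult_left_mono[OF B(2), of p "norm h"] by simp
  qed
  with assms show ?thesis unfolding support_fun_def by (rule cSUP_upper)
qed

lemma support_fun_least:
  assumes "\<And>p. p \<in> unit_figure F \<Longrightarrow> h \<bullet> p \<le> b" shows "support_fun F h \<le> b"
proof -
  have "0 \<in> unit_figure F" using quasinorm_simps(2)[of 0] by (simp add: unit_figure_def)
  then show ?thesis unfolding support_fun_def by (intro cSUP_least assms) auto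
qed

lemma support_fun_scaleR:
  assumes "c > 0" shows "support_fun F (c *\<^sub>R h) = c * support_fun F h"
proof -
  \<comment> \<open>One inequality for all factors is enough: it is used for \<open>c\<close> and
    for \<open>inverse c\<close>.\<close>
  have le: "support_fun F (c *\<^sub>R h) \<le> c * support_fun F h" if "c > 0" for c h
    using that by (intro support_fun_least) (simp add: support_fun_upper)
  have "support_fun F h \<le> inverse c * support_fun F (c *\<^sub>R h)"
    using le[of "inverse c" "c *\<^sub>R h"] assms by simp
  with le[OF assms, of h] assms show ?thesis by (simp add: field_simps)
qed

lemma support_fun_continuous: "continuous_on UNIV (support_fun F)"
proof -
  obtain B where B: "B > 0" "\<And>p. p \<in> unit_figure F \<Longrightarrow> norm p \<le> B"
    by (rule unit_figure_bounded) (rule that)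
  have le: "support_fun F h - support_fun F k \<le> B * dist h k" for h k
  proof -
    have "support_fun F h \<le> support_fun F k + B * dist h k"
    proof (rule support_fun_least)
      fix p assume p: "p \<in> unit_figure F"
      have "h \<bullet> p = k \<bullet> p + (h - k) \<bullet> p" by (simp add: inner_diff_left)
      also have "\<dots> \<le> support_fun F k + norm (h - k) * norm p"
        by (intro add_mono support_fun_upper p norm_cauchy_schwarz)
      also have "\<dots> \<le> support_fun F k + B * dist h k"
        using mult_left_mono[OF B(2)[OF p], of "norm (h - k)"] by (simp add: dist_norm mult.commute)
      finally show "h \<bullet> p \<le> support_fun F k + B * dist h k" .
    qed
    then show ?thesis by simp
  qed
  show ?thesis by (rule one_sided_lipschitz_continuous[OF less_imp_le[OF B(1)] le])
qed

lemma support_fun_pos: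
  assumes "h \<noteq> 0" shows "support_fun F h > 0"
proof -
  have Fh: "F h > 0" using assms quasinorm_simps(1,2)[of h] by linarith
  then have "F (inverse (F h) *\<^sub>R h) = 1" by (simp add: quasinorm_simps(3))
  then have "h \<bullet> (inverse (F h) *\<^sub>R h) \<le> support_fun F h"
    by (intro support_fun_upper) (simp add: unit_figure_def)
  moreover have "h \<bullet> (inverse (F h) *\<^sub>R h) > 0" using Fh assms by simp
  ultimately show ?thesis by linarith
qed

text \<open>If \<open>F p\<close> were below 1, rescaling \<open>p\<close> to the boundary of the
  unit figure would push \<open>h \<bullet> p\<close> above the maximum 1. This yields the
  parametrization by arc length.\<close>

lemma quasinorm_maximizer_eq_1:
  assumes "F p \<le> 1" "h \<bullet> p = 1" "support_fun F h = 1" shows "F p = 1"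
proof -
  have "p \<noteq> 0" using assms(2) by auto
  then have Fp: "F p > 0" using quasinorm_simps(1,2)[of p] by linarith
  then have "F (inverse (F p) *\<^sub>R p) = 1" by (simp add: quasinorm_simps(3))
  then have "h \<bullet> (inverse (F p) *\<^sub>R p) \<le> support_fun F h"
    by (intro support_fun_upper) (simp add: unit_figure_def)
  then have "1 \<le> F p" using assms(2,3) Fp by (simp add: field_simps)
  with assms(1) show ?thesis by simp
qed

lemma cos_sin_nonzero: "(cos \<theta>, sin \<theta>) \<noteq> (0 :: real \<times> real)"
  using sin_zero_abs_cos_one by (force simp: zero_prod_def)

lemma polar_radius_eq: "polar_radius F \<theta> = 1 / support_fun F (cos \<theta>, sin \<theta>)"
  unfolding polar_radius_def
proof (rule the_equality)
  have pos: "support_fun F (cos \<theta>, sin \<theta>) > 0" by (rule support_fun_pos[OF cos_sin_nonzero])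
  have eq: "support_fun F (r * cos \<theta>, r * sin \<theta>) = r * support_fun F (cos \<theta>, sin \<theta>)" if "r > 0" for r
    using support_fun_scaleR[OF that, of "(cos \<theta>, sin \<theta>)"] by simp
  show "1 / support_fun F (cos \<theta>, sin \<theta>) > 0 \<and> support_fun F (1 / support_fun F (cos \<theta>, sin \<theta>) * cos \<theta>,
      1 / support_fun F (cos \<theta>, sin \<theta>) * sin \<theta>) = 1"
    using eq[of "1 / support_fun F (cos \<theta>, sin \<theta>)"] pos by simp
  show "r = 1 / support_fun F (cos \<theta>, sin \<theta>)" if "0 < r \<and> support_fun F (r * cos \<theta>, r * sin \<theta>) = 1" for r
    using that eq[of r] pos by (simp add: field_simps)
qed

lemma polar_radius_pos: "polar_radius F \<theta> > 0"
  using support_fun_pos[OF cos_sin_nonzero] by (simp add: polar_radius_eq)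

lemma polar_radius_continuous: "continuous_on UNIV (polar_radius F)"
  unfolding polar_radius_eq[abs_def]
  using support_fun_pos[OF cos_sin_nonzero]
  by (intro continuous_intros continuous_on_compose2[OF support_fun_continuous]) (auto simp: less_imp_neq[symmetric])

lemma polar_radius_periodic: "polar_radius F (\<theta> + 2 * pi) = polar_radius F \<theta>"
  by (simp add: polar_radius_eq)

text \<open>\<open>R\<close> measures twice the area of a sector of the polar figure.\<close>

lemma polar_radius_antiderivative:
  obtains R where "\<And>\<theta>. (R has_real_derivative (polar_radius F \<theta>)\<^sup>2) (at \<theta>)"
    "\<And>\<theta>. R (\<theta> + 2 * pi) = R \<theta> + 2 * measure lebesgue (polar_figure F)" "strict_mono R"
proof -
  define R where "R = (\<lambda>\<eta>. LBINT \<xi>=ereal 0..ereal \<eta>. (polar_radius F \<xi>)\<^sup>2)"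
  have cont: "continuous_on S (\<lambda>\<xi>. (polar_radius F \<xi>)\<^sup>2)" for S
    by (intro continuous_intros continuous_on_subset[OF polar_radius_continuous]) auto
  have R: "(R has_real_derivative (polar_radius F \<theta>)\<^sup>2) (at \<theta>)" for \<theta>
  proof -
    have "(R has_vector_derivative (polar_radius F \<theta>)\<^sup>2) (at \<theta> within {-\<bar>\<theta>\<bar> - 1..\<bar>\<theta>\<bar> + 1})"
      unfolding R_def by (rule interval_integral_FTC2) (auto intro: cont)
    then show ?thesis
      by (simp add: has_real_derivative_iff_has_vector_derivative at_within_Icc_at)
  qed
  have mono: "strict_mono R"
  proof (rule strict_monoI)
    fix a b :: real assume "a < b"
    then show "R a < R b"
    proof (rule DERIV_pos_imp_increasing)
      fix \<theta>
      show "\<exists>y. (R has_real_derivative y) (at \<theta>) \<and> 0 < y"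
        using R[of \<theta>] polar_radius_pos[of \<theta>] by (intro exI[of _ "(polar_radius F \<theta>)\<^sup>2"]) simp
    qed
  qed
  \<comment> \<open>By periodicity of the radius the increment over a turn does not depend on the
    starting angle; -pi/2 is the one at which the area formula starts.\<close>
  have const: "R (\<theta> + 2 * pi) - R \<theta> = R (-(pi/2) + 2 * pi) - R (-(pi/2))" for \<theta>
  proof (rule DERIV_isconst_all[of "\<lambda>\<theta>. R (\<theta> + 2 * pi) - R \<theta>"], rule allI)
    fix \<theta>
    have "((\<lambda>\<theta>. R (\<theta> + 2 * pi)) has_real_derivative (polar_radius F \<theta>)\<^sup>2) (at \<theta>)"
      using R[of "\<theta> + 2 * pi"] by (simp add: DERIV_shift polar_radius_periodic)
    from DERIV_diff[OF this R[of \<theta>]] show "((\<lambda>\<theta>. R (\<theta> + 2 * pi) - R \<theta>) has_real_derivative 0) (at \<theta>)"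
      by simp
  qed
  have "measure lebesgue (polar_figure F) = (R (3 * pi / 2) - R (-(pi/2))) / 2"
    unfolding polar_figure_def
    using R by (intro measure_star_figure_polar support_fun_continuous support_fun_scaleR support_fun_pos)
      (simp_all add: polar_radius_eq power_divide)
  moreover have "-(pi/2) + 2 * pi = 3 * pi / 2" by simp
  ultimately have "R (\<theta> + 2 * pi) = R \<theta> + 2 * measure lebesgue (polar_figure F)" for \<theta>
    using const[of \<theta>] by (simp add: field_simps)
  with R mono show ?thesis using that by blast
qed

end

section \<open>Extremals with vanishing \<open>\<phi>4\<close> and \<open>\<phi>5\<close>\<close>

lemma locally_abs_cont_dist_mono:
  assumes g: "locally_abs_cont g" and le: "\<And>s t. dist (f s) (f t) \<le> dist (g s) (g t)"
  shows "locally_abs_cont f"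
  unfolding locally_abs_cont_def abs_cont_on_def
proof (intro allI impI)
  fix a b \<epsilon> :: real assume "\<epsilon> > 0"
  then obtain \<delta> where \<delta>: "\<delta> > 0" and ac: "\<forall>(n::nat) A B. (\<forall>i<n. A i \<le> B i \<and> {A i..B i} \<subseteq> {a..b}) \<and>
        disjoint_family_on (\<lambda>i. {A i<..<B i}) {..<n} \<and> (\<Sum>i<n. B i - A i) < \<delta> \<longrightarrow>
        (\<Sum>i<n. dist (g (A i)) (g (B i))) < \<epsilon>"
    using g unfolding locally_abs_cont_def abs_cont_on_def by meson
  show "\<exists>\<delta>>0. \<forall>(n::nat) A B. (\<forall>i<n. A i \<le> B i \<and> {A i..B i} \<subseteq> {a..b}) \<and>
        disjoint_family_on (\<lambda>i. {A i<..<B i}) {..<n} \<and> (\<Sum>i<n. B i - A i) < \<delta> \<longrightarrow>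
        (\<Sum>i<n. dist (f (A i)) (f (B i))) < \<epsilon>"
  proof (intro exI[of _ \<delta>] conjI \<delta> allI impI)
    fix n :: nat and A B
    assume "(\<forall>i<n. A i \<le> B i \<and> {A i..B i} \<subseteq> {a..b}) \<and>
        disjoint_family_on (\<lambda>i. {A i<..<B i}) {..<n} \<and> (\<Sum>i<n. B i - A i) < \<delta>"
    then have "(\<Sum>i<n. dist (g (A i)) (g (B i))) < \<epsilon>"
      using ac by simp
    moreover have "(\<Sum>i<n. dist (f (A i)) (f (B i))) \<le> (\<Sum>i<n. dist (g (A i)) (g (B i)))"
      by (rule sum_mono) (rule le)
    ultimately show "(\<Sum>i<n. dist (f (A i)) (f (B i))) < \<epsilon>" by linarith
  qed
qed

lemma locally_abs_cont_components:
  assumes "locally_abs_cont g"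
  shows "locally_abs_cont (\<lambda>t. fst (g t))" "locally_abs_cont (\<lambda>t. snd (g t))"
  by (rule locally_abs_cont_dist_mono[OF assms], simp add: dist_fst_le dist_snd_le)+

lemma has_vector_derivative_components:
  assumes "(g has_vector_derivative d) (at t)"
  shows "((\<lambda>t. fst (g t)) has_vector_derivative fst d) (at t)"
    "((\<lambda>t. snd (g t)) has_vector_derivative snd d) (at t)"
  using bounded_linear.has_vector_derivative[OF bounded_linear_fst assms]
    bounded_linear.has_vector_derivative[OF bounded_linear_snd assms] by simp_all

text \<open>The coordinate equations of a trajectory all have this form: continuous coefficients
  times bounded controls, hence a locally bounded derivative.\<close>

lemma has_ae_derivative_controlled:
  assumes f: "locally_abs_cont f"
    and der: "AE t in lebesgue. (f has_real_derivative a t * p t + b t * q t) (at t)"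
    and cont: "continuous_on UNIV a" "continuous_on UNIV b"
    and B: "\<And>t. \<bar>p t\<bar> \<le> B" "\<And>t. \<bar>q t\<bar> \<le> B"
  shows "has_ae_derivative f (\<lambda>t. a t * p t + b t * q t)"
proof (rule has_ae_derivative_of_abs_cont[OF f der])
  fix R
  obtain M where M: "M > 0" "\<And>t. t \<in> {-R..R} \<Longrightarrow> \<bar>a t\<bar> \<le> M"
    by (rule continuous_on_Icc_bounded[OF cont(1)]) (rule that)
  obtain N where N: "N > 0" "\<And>t. t \<in> {-R..R} \<Longrightarrow> \<bar>b t\<bar> \<le> N"
    by (rule continuous_on_Icc_bounded[OF cont(2)]) (rule that)
  have "\<bar>a t * p t + b t * q t\<bar> \<le> M * B + N * B" if "t \<in> {-R..R}" for t
  proof -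
    have "\<bar>a t * p t\<bar> \<le> M * B" "\<bar>b t * q t\<bar> \<le> N * B"
      unfolding abs_mult using M(2)[OF that] N(2)[OF that] B[of t] M(1) N(1)
      by (intro mult_mono; simp)+
    then show ?thesis by linarith
  qed
  then show "\<exists>K. AE t in lebesgue. t \<in> {-R..R} \<longrightarrow> \<bar>a t * p t + b t * q t\<bar> \<le> K"
    by (intro exI[of _ "M * B + N * B"] AE_I2) simp
qed

text \<open>A nonempty open set is not negligible. This upgrades the condition
  \<open>support_fun F (h1 t, h2 t) = 1\<close> from almost every time to every time.\<close>

lemma continuous_AE_eq_const:
  fixes f :: "real \<Rightarrow> real"
  assumes "continuous_on UNIV f" "AE t in lebesgue. f t = c" shows "f t = c"
proof (rule ccontr)
  assume "f t \<noteq> c"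
  have "open {t. f t \<noteq> c}"
    using assms(1) by (intro open_Collect_neq) auto
  moreover have "negligible {t. f t \<noteq> c}"
    using assms(2) unfolding eventually_ae_filter_negligible by (auto intro: negligible_subset)
  ultimately have "{t. f t \<noteq> c} = {}"
    using open_not_negligible by blast
  with \<open>f t \<noteq> c\<close> show False by blast
qed

lemma trajectory_control_bounded:
  assumes "quasinorm F" "trajectory F g u"
  obtains B where "B > 0" "\<And>t. \<bar>fst (u t)\<bar> \<le> B" "\<And>t. \<bar>snd (u t)\<bar> \<le> B"
proof -
  obtain B where B: "B > 0" "\<And>p. p \<in> unit_figure F \<Longrightarrow> norm p \<le> B"
    by (rule unit_figure_bounded[OF assms(1)]) (rule that)
  have "\<bar>fst (u t)\<bar> \<le> B \<and> \<bar>snd (u t)\<bar> \<le> B" for t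
    using B(2)[of "u t"] assms(2) norm_fst_le[of "fst (u t)" "snd (u t)"] norm_snd_le[of "snd (u t)" "fst (u t)"]
    by (auto simp: trajectory_def)
  with B(1) show ?thesis using that by blast
qed

lemma trajectory_has_ae_derivative:
  assumes F: "quasinorm F" and tr: "trajectory F (\<lambda>t. (x t, y t, z t, v t, w t)) u"
  shows "has_ae_derivative x (\<lambda>t. fst (u t))" "has_ae_derivative y (\<lambda>t. snd (u t))"
    "has_ae_derivative z (\<lambda>t. (- y t / 2) * fst (u t) + (x t / 2) * snd (u t))"
    "has_ae_derivative v (\<lambda>t. (- (z t + x t * y t / 6) / 2) * fst (u t) + ((x t)\<^sup>2 / 12) * snd (u t))"
    "has_ae_derivative w (\<lambda>t. (- ((y t)\<^sup>2) / 12) * fst (u t) + (- (z t - x t * y t / 6) / 2) * snd (u t))"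
proof -
  obtain B where B: "B > 0" "\<And>t. \<bar>fst (u t)\<bar> \<le> B" "\<And>t. \<bar>snd (u t)\<bar> \<le> B"
    by (rule trajectory_control_bounded[OF F tr]) (rule that)
  let ?g = "\<lambda>t. (x t, y t, z t, v t, w t)"
  have ac: "locally_abs_cont ?g" using tr by (simp add: trajectory_def)
  note ac1 = locally_abs_cont_components[OF ac, simplified]
  note ac2 = locally_abs_cont_components[OF ac1(2), simplified]
  note ac3 = locally_abs_cont_components[OF ac2(2), simplified]
  note ac4 = locally_abs_cont_components[OF ac3(2), simplified]
  have all: "AE t in lebesgue. (x has_real_derivative fst (u t)) (at t) \<and>
     (y has_real_derivative snd (u t)) (at t) \<and>
     (z has_real_derivative (- y t / 2) * fst (u t) + (x t / 2) * snd (u t)) (at t) \<and>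
     (v has_real_derivative (- (z t + x t * y t / 6) / 2) * fst (u t) + ((x t)\<^sup>2 / 12) * snd (u t)) (at t) \<and>
     (w has_real_derivative (- ((y t)\<^sup>2) / 12) * fst (u t) + (- (z t - x t * y t / 6) / 2) * snd (u t)) (at t)"
  proof -
    have "AE t in lebesgue. (?g has_vector_derivative
        fst (u t) *\<^sub>R cartan_X (?g t) + snd (u t) *\<^sub>R cartan_Y (?g t)) (at t)"
      using tr by (simp add: trajectory_def)
    then show ?thesis
    proof eventually_elim
      case (elim t)
      note d1 = has_vector_derivative_components[OF elim]
      note d2 = has_vector_derivative_components[OF d1(2)]
      note d3 = has_vector_derivative_components[OF d2(2)]
      note d4 = has_vector_derivative_components[OF d3(2)]
      from d1(1) d2(1) d3(1) d4 show ?case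
        by (simp add: has_real_derivative_iff_has_vector_derivative cartan_X_def cartan_Y_def mult.commute)
    qed
  qed
  show x: "has_ae_derivative x (\<lambda>t. fst (u t))"
    using has_ae_derivative_controlled[of x "\<lambda>_. 1" "\<lambda>t. fst (u t)" "\<lambda>_. 0" "\<lambda>t. snd (u t)" B] ac1(1) all B by simp
  show y: "has_ae_derivative y (\<lambda>t. snd (u t))"
    using has_ae_derivative_controlled[of y "\<lambda>_. 0" "\<lambda>t. fst (u t)" "\<lambda>_. 1" "\<lambda>t. snd (u t)" B] ac2(1) all B by simp
  \<comment> \<open>The system is triangular: the coefficients for \<open>z\<close> involve
    \<open>x\<close> and \<open>y\<close>, those for \<open>v\<close> and \<open>w\<close> also
    \<open>z\<close>, so continuity is established in this order.\<close>
  have xy: "continuous_on UNIV x" "continuous_on UNIV y"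
    using x y by (simp_all add: has_ae_derivative_def locally_lipschitz_continuous)
  show z: "has_ae_derivative z (\<lambda>t. (- y t / 2) * fst (u t) + (x t / 2) * snd (u t))"
    using all by (intro has_ae_derivative_controlled[OF ac3(1) _ _ _ B(2,3)] continuous_intros xy) auto
  have zc: "continuous_on UNIV z"
    using z by (simp add: has_ae_derivative_def locally_lipschitz_continuous)
  show "has_ae_derivative v (\<lambda>t. (- (z t + x t * y t / 6) / 2) * fst (u t) + ((x t)\<^sup>2 / 12) * snd (u t))"
    using all by (intro has_ae_derivative_controlled[OF ac4(1) _ _ _ B(2,3)] continuous_intros xy zc) auto
  show "has_ae_derivative w (\<lambda>t. (- ((y t)\<^sup>2) / 12) * fst (u t) + (- (z t - x t * y t / 6) / 2) * snd (u t))"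
    using all by (intro has_ae_derivative_controlled[OF ac4(2) _ _ _ B(2,3)] continuous_intros xy zc) auto
qed

section \<open>The adjoint equation\<close>

lemma GDERIV_directional:
  assumes "GDERIV f q :> D"
  shows "((\<lambda>s. f (q + s *\<^sub>R e)) has_real_derivative e \<bullet> D) (at 0)"
proof -
  have "((\<lambda>s. q + s *\<^sub>R e) has_derivative (\<lambda>s. s *\<^sub>R e)) (at 0)"
    by (auto intro!: derivative_eq_intros)
  moreover have "(f has_derivative (\<lambda>h. h \<bullet> D)) (at (q + 0 *\<^sub>R e))"
    using assms by (simp add: gderiv_def)
  ultimately have "((\<lambda>s. f (q + s *\<^sub>R e)) has_derivative (\<lambda>s. (s *\<^sub>R e) \<bullet> D)) (at 0)"
    by (rule has_derivative_compose)
  then show ?thesis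
    by (simp add: has_field_derivative_def mult_commute_abs)
qed

text \<open>Along each coordinate axis the Hamiltonian is a polynomial in one variable, and
  uniqueness of its derivative identifies the matching component of the gradient. Since
  \<open>v\<close> and \<open>w\<close> do not occur in the Hamiltonian, the last two components
  vanish.\<close>

lemma hamiltonian_gradient:
  assumes D: "GDERIV (\<lambda>q. hamiltonian (p1, p2, p3, p4, p5) q p) (x, y, z, v, w) :> (d1, d2, d3, d4, d5)"
  shows "d1 = - p4 * y / 12 * fst p + (p3 / 2 + p4 * x / 6 + p5 * y / 12) * snd p"
    "d2 = (- p3 / 2 - p4 * x / 12 - p5 * y / 6) * fst p + p5 * x / 12 * snd p"
    "d3 = - p4 / 2 * fst p - p5 / 2 * snd p"
    "d4 = 0" "d5 = 0"
proof -
  note dir = GDERIV_directional[OF D]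
  show "d1 = - p4 * y / 12 * fst p + (p3 / 2 + p4 * x / 6 + p5 * y / 12) * snd p"
    by (rule DERIV_unique[OF dir[of "(1, 0, 0, 0, 0)", simplified hamiltonian_def add_Pair scaleR_Pair ham1_coords ham2_coords, simplified]])
      (auto intro!: derivative_eq_intros simp: algebra_simps)
  show "d2 = (- p3 / 2 - p4 * x / 12 - p5 * y / 6) * fst p + p5 * x / 12 * snd p"
    by (rule DERIV_unique[OF dir[of "(0, 1, 0, 0, 0)", simplified hamiltonian_def add_Pair scaleR_Pair ham1_coords ham2_coords, simplified]])
      (auto intro!: derivative_eq_intros simp: algebra_simps)
  show "d3 = - p4 / 2 * fst p - p5 / 2 * snd p"
    by (rule DERIV_unique[OF dir[of "(0, 0, 1, 0, 0)", simplified hamiltonian_def add_Pair scaleR_Pair ham1_coords ham2_coords, simplified]])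
      (auto intro!: derivative_eq_intros simp: algebra_simps)
  show "d4 = 0"
    by (rule DERIV_unique[OF dir[of "(0, 0, 0, 1, 0)", simplified hamiltonian_def add_Pair scaleR_Pair ham1_coords ham2_coords, simplified]])
      (auto intro!: derivative_eq_intros simp: algebra_simps)
  show "d5 = 0"
    by (rule DERIV_unique[OF dir[of "(0, 0, 0, 0, 1)", simplified hamiltonian_def add_Pair scaleR_Pair ham1_coords ham2_coords, simplified]])
      (auto intro!: derivative_eq_intros simp: algebra_simps)
qed

text \<open>The equations decouple from the last component upwards: the fourth and fifth are
  conserved and start at 0, which makes the third constant, and the first two are then driven by the
  derivatives of \<open>y\<close> and \<open>x\<close> alone.\<close>

lemma extremal_covector:
  assumes F: "quasinorm F" and ex: "extremal F (\<lambda>t. (x t, y t, z t, v t, w t)) u \<psi>"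
    and 0: "x 0 = 0" "y 0 = 0" "\<psi> 0 = (\<phi>1, \<phi>2, \<phi>3, 0, 0)"
  shows "\<psi> t = (\<phi>1 - \<phi>3 / 2 * y t, \<phi>2 + \<phi>3 / 2 * x t, \<phi>3, 0, 0)"
proof -
  define q1 q2 q3 q4 q5 where q: "q1 = (\<lambda>t. fst (\<psi> t))" "q2 = (\<lambda>t. fst (snd (\<psi> t)))"
    "q3 = (\<lambda>t. fst (snd (snd (\<psi> t))))" "q4 = (\<lambda>t. fst (snd (snd (snd (\<psi> t)))))"
    "q5 = (\<lambda>t. snd (snd (snd (snd (\<psi> t)))))"
  have \<psi>: "\<psi> t = (q1 t, q2 t, q3 t, q4 t, q5 t)" for t by (simp add: q)
  have tr: "trajectory F (\<lambda>t. (x t, y t, z t, v t, w t)) u" and ac: "locally_abs_cont \<psi>"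
    using ex by (simp_all add: extremal_def)
  note ac1 = locally_abs_cont_components[OF ac]
  note ac2 = locally_abs_cont_components[OF ac1(2)]
  note ac3 = locally_abs_cont_components[OF ac2(2)]
  note ac4 = locally_abs_cont_components[OF ac3(2)]
  note ac = ac1(1)[folded q] ac2(1)[folded q] ac3(1)[folded q] ac4[folded q]
  obtain B where B: "B > 0" "\<And>t. \<bar>fst (u t)\<bar> \<le> B" "\<And>t. \<bar>snd (u t)\<bar> \<le> B"
    by (rule trajectory_control_bounded[OF F tr]) (rule that)
  note xy = trajectory_has_ae_derivative(1,2)[OF F tr]
  have all: "AE t in lebesgue.
     (q1 has_real_derivative - (- q4 t * y t / 12 * fst (u t) + (q3 t / 2 + q4 t * x t / 6 + q5 t * y t / 12) * snd (u t))) (at t) \<and>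
     (q2 has_real_derivative - ((- q3 t / 2 - q4 t * x t / 12 - q5 t * y t / 6) * fst (u t) + q5 t * x t / 12 * snd (u t))) (at t) \<and>
     (q3 has_real_derivative - (- q4 t / 2 * fst (u t) - q5 t / 2 * snd (u t))) (at t) \<and>
     (q4 has_real_derivative 0) (at t) \<and> (q5 has_real_derivative 0) (at t)"
  proof -
    have "AE t in lebesgue. \<exists>D. (GDERIV (\<lambda>q. hamiltonian (\<psi> t) q (u t)) (x t, y t, z t, v t, w t) :> D) \<and>
        (\<psi> has_vector_derivative - D) (at t)"
      using ex by (simp add: extremal_def)
    then show ?thesis
    proof eventually_elim
      case (elim t)
      then obtain d1 d2 d3 d4 d5 where
        D: "GDERIV (\<lambda>q. hamiltonian (\<psi> t) q (u t)) (x t, y t, z t, v t, w t) :> (d1, d2, d3, d4, d5)"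
        and d: "(\<psi> has_vector_derivative - (d1, d2, d3, d4, d5)) (at t)"
        by (metis prod.exhaust)
      note c1 = has_vector_derivative_components[OF d]
      note c2 = has_vector_derivative_components[OF c1(2)]
      note c3 = has_vector_derivative_components[OF c2(2)]
      note c4 = has_vector_derivative_components[OF c3(2)]
      note g = hamiltonian_gradient[OF D[unfolded \<psi>[of t]]]
      from c1(1) c2(1) c3(1) c4 show ?case
        unfolding q[symmetric] g[symmetric] has_real_derivative_iff_has_vector_derivative
        using g(4,5) by simp
    qed
  qed
  have zero: "has_ae_derivative f (\<lambda>t. 0)" if "locally_abs_cont f" "AE t in lebesgue. (f has_real_derivative 0) (at t)" for f
    using has_ae_derivative_controlled[OF that(1), of "\<lambda>_. 0" "\<lambda>_. 0" "\<lambda>_. 0" "\<lambda>_. 0" 0] that(2) by simp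
  have q4: "q4 t = 0" for t
    using has_ae_derivative_unique[OF zero[OF ac(4)] has_ae_derivative_const[of 0]] all 0 \<psi>[of 0] by simp
  have q5: "q5 t = 0" for t
    using has_ae_derivative_unique[OF zero[OF ac(5)] has_ae_derivative_const[of 0]] all 0 \<psi>[of 0] by simp
  have q3: "q3 t = \<phi>3" for t
    using has_ae_derivative_unique[OF zero[OF ac(3)] has_ae_derivative_const[of \<phi>3]] all 0 \<psi>[of 0] by (simp add: q4 q5)
  have "AE t in lebesgue. (q1 has_real_derivative 0 * fst (u t) + (- (\<phi>3 / 2)) * snd (u t)) (at t)"
    using all by eventually_elim (simp add: q3 q4 q5)
  then have "has_ae_derivative q1 (\<lambda>t. 0 * fst (u t) + (- (\<phi>3 / 2)) * snd (u t))"
    using has_ae_derivative_controlled[of q1 "\<lambda>_. 0" "\<lambda>t. fst (u t)" "\<lambda>_. - (\<phi>3 / 2)" "\<lambda>t. snd (u t)" B] ac(1) B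
    by (simp only: continuous_on_const)
  moreover have "has_ae_derivative (\<lambda>t. \<phi>1 - \<phi>3 / 2 * y t) (\<lambda>t. 0 * fst (u t) + (- (\<phi>3 / 2)) * snd (u t))"
    using has_ae_derivative_diff[OF has_ae_derivative_const[of \<phi>1] has_ae_derivative_cmult[OF xy(2), of "\<phi>3 / 2"]]
    by simp
  ultimately have q1: "q1 t = \<phi>1 - \<phi>3 / 2 * y t" for t
    by (rule has_ae_derivative_unique) (use 0 \<psi>[of 0] in simp)
  have "AE t in lebesgue. (q2 has_real_derivative (\<phi>3 / 2) * fst (u t) + 0 * snd (u t)) (at t)"
    using all by eventually_elim (simp add: q3 q4 q5)
  then have "has_ae_derivative q2 (\<lambda>t. (\<phi>3 / 2) * fst (u t) + 0 * snd (u t))"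
    using has_ae_derivative_controlled[of q2 "\<lambda>_. \<phi>3 / 2" "\<lambda>t. fst (u t)" "\<lambda>_. 0" "\<lambda>t. snd (u t)" B] ac(2) B
    by (simp only: continuous_on_const)
  moreover have "has_ae_derivative (\<lambda>t. \<phi>2 + \<phi>3 / 2 * x t) (\<lambda>t. (\<phi>3 / 2) * fst (u t) + 0 * snd (u t))"
    using has_ae_derivative_add[OF has_ae_derivative_const[of \<phi>2] has_ae_derivative_cmult[OF xy(1), of "\<phi>3 / 2"]]
    by simp
  ultimately have q2: "q2 t = \<phi>2 + \<phi>3 / 2 * x t" for t
    by (rule has_ae_derivative_unique) (use 0 \<psi>[of 0] in simp)
  show ?thesis by (simp add: \<psi> q1 q2 q3 q4 q5)
qed

section \<open>Swept area\<close>

text \<open>The area of one triangle differs from the increment of \<open>z\<close> by a term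
  quadratic in the time step, so the total error is at most a constant times the mesh times
  \<open>\<bar>b - a\<bar>\<close>.\<close>

lemma has_swept_area_of_ae_derivative:
  assumes x: "has_ae_derivative x p" and y: "has_ae_derivative y q"
    and B: "\<And>t. \<bar>p t\<bar> \<le> B" "\<And>t. \<bar>q t\<bar> \<le> B"
    and z: "has_ae_derivative z (\<lambda>t. (- y t / 2) * p t + (x t / 2) * q t)"
  shows "has_swept_area (\<lambda>\<tau>. (x \<tau>, y \<tau>)) a b (z b - z a)"
proof -
  let ?A = "\<lambda>s t. oriented_triangle_area (x s, y s) (x t, y t)"
  have B0: "B \<ge> 0" using B(1)[of 0] by linarith
  have lip: "\<bar>x t - x s\<bar> \<le> B * \<bar>t - s\<bar>" "\<bar>y t - y s\<bar> \<le> B * \<bar>t - s\<bar>" for s t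
    using has_ae_derivative_increment_bound[OF x B0] has_ae_derivative_increment_bound[OF y B0] B by simp_all
  have quad: "\<bar>?A s t - (z t - z s)\<bar> \<le> B\<^sup>2 * \<bar>t - s\<bar> * \<bar>t - s\<bar>" for s t
  proof -
    \<comment> \<open>With the vertex at time \<open>s\<close> fixed, \<open>f r\<close> is
      \<open>z r\<close> minus the triangle area up to time \<open>r\<close>. Its derivative
      contains only differences from the values at \<open>s\<close>, each at most
      \<open>B * \<bar>t - s\<bar>\<close>.\<close>
    define f where "f = (\<lambda>r. z r - (x s / 2 * y r - y s / 2 * x r))"
    have f: "has_ae_derivative f (\<lambda>r. (- y r / 2) * p r + (x r / 2) * q r - (x s / 2 * q r - y s / 2 * p r))"
      unfolding f_def by (intro has_ae_derivative_diff has_ae_derivative_cmult x y z)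
    have bd: "\<bar>(- y r / 2) * p r + (x r / 2) * q r - (x s / 2 * q r - y s / 2 * p r)\<bar> \<le> B\<^sup>2 * \<bar>t - s\<bar>"
      if r: "r \<in> closed_segment s t" for r
    proof -
      have rs: "\<bar>r - s\<bar> \<le> \<bar>t - s\<bar>" using r by (auto simp: closed_segment_eq_real_ivl split: if_splits)
      have *: "\<bar>(x r - x s) * q r\<bar> \<le> (B * \<bar>t - s\<bar>) * B" "\<bar>(y r - y s) * p r\<bar> \<le> (B * \<bar>t - s\<bar>) * B"
        unfolding abs_mult using B[of r] order_trans[OF lip(1) mult_left_mono[OF rs B0]]
          order_trans[OF lip(2) mult_left_mono[OF rs B0]] B0
        by (intro mult_mono; simp)+
      have "(- y r / 2) * p r + (x r / 2) * q r - (x s / 2 * q r - y s / 2 * p r)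
          = ((x r - x s) * q r - (y r - y s) * p r) / 2" by (simp add: field_simps)
      moreover have "(B * \<bar>t - s\<bar>) * B = B\<^sup>2 * \<bar>t - s\<bar>" by (simp add: power2_eq_square)
      moreover have "\<bar>(c - d) / 2\<bar> \<le> K" if "\<bar>c\<bar> \<le> K" "\<bar>d\<bar> \<le> K" for c d K :: real
        using that abs_triangle_ineq4[of c d] by simp
      note this[OF *]
      ultimately show ?thesis by (simp only:)
    qed
    have "\<bar>f t - f s\<bar> \<le> B\<^sup>2 * \<bar>t - s\<bar> * \<bar>t - s\<bar>"
      using bd by (intro has_ae_derivative_increment_bound[OF f]) simp_all
    moreover have "f t - f s = - (?A s t - (z t - z s))"
      by (simp add: f_def oriented_triangle_area_def field_simps)
    ultimately show ?thesis by simp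
  qed
  show ?thesis
    unfolding has_swept_area_def
  proof (intro allI impI)
    fix \<epsilon> :: real assume \<epsilon>: "\<epsilon> > 0"
    \<comment> \<open>The \<open>+ 1\<close> keeps the denominator positive if \<open>a = b\<close>
      or \<open>B = 0\<close>.\<close>
    define \<delta> where "\<delta> = \<epsilon> / (B\<^sup>2 * \<bar>b - a\<bar> + 1)"
    have den: "B\<^sup>2 * \<bar>b - a\<bar> + 1 > 0" by (simp add: add_nonneg_pos)
    have \<delta>: "\<delta> > 0" "B\<^sup>2 * \<bar>b - a\<bar> * \<delta> < \<epsilon>"
      using \<epsilon> den by (auto simp: \<delta>_def pos_divide_less_eq distrib_left mult.commute)
    have "\<bar>(\<Sum>i<n. ?A (r i) (r (Suc i))) - (z b - z a)\<bar> < \<epsilon>"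
      if r: "r 0 = a" "r n = b" and mono: "(\<forall>i<n. r i \<le> r (Suc i)) \<or> (\<forall>i<n. r (Suc i) \<le> r i)"
        and mesh: "\<forall>i<n. \<bar>r (Suc i) - r i\<bar> < \<delta>" for n :: nat and r
    proof -
      have len: "(\<Sum>i<n. \<bar>r (Suc i) - r i\<bar>) = \<bar>b - a\<bar>"
        using mono
      proof
        assume m: "\<forall>i<n. r i \<le> r (Suc i)"
        then have "(\<Sum>i<n. \<bar>r (Suc i) - r i\<bar>) = (\<Sum>i<n. r (Suc i) - r i)"
          by (intro sum.cong) auto
        also have "\<dots> = b - a" using r by (simp add: sum_lessThan_telescope)
        finally have eq: "(\<Sum>i<n. \<bar>r (Suc i) - r i\<bar>) = b - a" .
        moreover have "0 \<le> (\<Sum>i<n. \<bar>r (Suc i) - r i\<bar>)" by (rule sum_nonneg) simp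
        ultimately show ?thesis by simp
      next
        assume m: "\<forall>i<n. r (Suc i) \<le> r i"
        then have "(\<Sum>i<n. \<bar>r (Suc i) - r i\<bar>) = (\<Sum>i<n. r i - r (Suc i))"
          by (intro sum.cong) auto
        also have "\<dots> = a - b" using r by (simp add: sum_lessThan_telescope')
        finally have eq: "(\<Sum>i<n. \<bar>r (Suc i) - r i\<bar>) = a - b" .
        moreover have "0 \<le> (\<Sum>i<n. \<bar>r (Suc i) - r i\<bar>)" by (rule sum_nonneg) simp
        ultimately show ?thesis by simp
      qed
      have "z b - z a = (\<Sum>i<n. z (r (Suc i)) - z (r i))"
        using r sum_lessThan_telescope[of "\<lambda>i. z (r i)" n] by simp
      then have "(\<Sum>i<n. ?A (r i) (r (Suc i))) - (z b - z a)
          = (\<Sum>i<n. ?A (r i) (r (Suc i)) - (z (r (Suc i)) - z (r i)))"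
        by (simp add: sum_subtractf)
      also have "\<bar>\<dots>\<bar> \<le> (\<Sum>i<n. B\<^sup>2 * \<delta> * \<bar>r (Suc i) - r i\<bar>)"
      proof (rule order_trans[OF sum_abs sum_mono])
        fix i assume "i \<in> {..<n}"
        then have "\<bar>r (Suc i) - r i\<bar> \<le> \<delta>" using mesh by (simp add: less_imp_le)
        then have "B\<^sup>2 * \<bar>r (Suc i) - r i\<bar> * \<bar>r (Suc i) - r i\<bar> \<le> B\<^sup>2 * \<delta> * \<bar>r (Suc i) - r i\<bar>"
          by (intro mult_right_mono mult_left_mono) simp_all
        with quad[of "r i" "r (Suc i)"]
        show "\<bar>?A (r i) (r (Suc i)) - (z (r (Suc i)) - z (r i))\<bar> \<le> B\<^sup>2 * \<delta> * \<bar>r (Suc i) - r i\<bar>"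
          by (rule order_trans)
      qed
      also have "\<dots> = B\<^sup>2 * \<bar>b - a\<bar> * \<delta>"
        by (simp add: sum_distrib_left[symmetric] len)
      finally show ?thesis using \<delta>(2) by linarith
    qed
    with \<delta>(1) show "\<exists>\<delta>>0. \<forall>n r. r 0 = a \<and> r n = b \<and>
        ((\<forall>i<n. r i \<le> r (Suc i)) \<or> (\<forall>i<n. r (Suc i) \<le> r i)) \<and>
        (\<forall>i<n. \<bar>r (Suc i) - r i\<bar> < \<delta>)
        \<longrightarrow> \<bar>(\<Sum>i<n. ?A (r i) (r (Suc i))) - (z b - z a)\<bar> < \<epsilon>"
      by (intro exI[of _ \<delta>]) simp
  qed
qed

section \<open>The planar projection: angle, period and isoperimetrix\<close>

text \<open>The angle, the period and the isoperimetrix depend only on these planar data, so the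
  other group coordinates and the covector are left behind. The sign of \<phi>3 stays open; it
  decides the sense of rotation.\<close>

locale planar_extremal =
  fixes F :: "real \<times> real \<Rightarrow> real" and x y h1 h2 p q :: "real \<Rightarrow> real" and \<phi>1 \<phi>2 \<phi>3 B :: real
  assumes F: "quasinorm F"
    and x: "has_ae_derivative x p" and y: "has_ae_derivative y q"
    and B: "B > 0" "\<And>t. \<bar>p t\<bar> \<le> B" "\<And>t. \<bar>q t\<bar> \<le> B"
    and h: "\<And>t. h1 t = \<phi>1 - \<phi>3 * y t" "\<And>t. h2 t = \<phi>2 + \<phi>3 * x t"
    and \<phi>3: "\<phi>3 \<noteq> 0"
    and unit: "\<And>t. support_fun F (h1 t, h2 t) = 1"
    and maximum: "AE t in lebesgue. h1 t * p t + h2 t * q t = 1"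
begin

lemma h_has_ae_derivative:
  "has_ae_derivative h1 (\<lambda>t. - \<phi>3 * q t)" "has_ae_derivative h2 (\<lambda>t. \<phi>3 * p t)"
proof -
  have eq: "h1 = (\<lambda>t. \<phi>1 - \<phi>3 * y t)" "h2 = (\<lambda>t. \<phi>2 + \<phi>3 * x t)"
    by (rule ext, rule h)+
  show "has_ae_derivative h1 (\<lambda>t. - \<phi>3 * q t)"
    using has_ae_derivative_diff[OF has_ae_derivative_const[of \<phi>1] has_ae_derivative_cmult[OF y, of \<phi>3]]
    by (simp add: eq)
  show "has_ae_derivative h2 (\<lambda>t. \<phi>3 * p t)"
    using has_ae_derivative_add[OF has_ae_derivative_const[of \<phi>2] has_ae_derivative_cmult[OF x, of \<phi>3]]
    by (simp add: eq)
qed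

lemma h_continuous: "continuous_on S h1" "continuous_on S h2"
  using h_has_ae_derivative by (simp_all add: has_ae_derivative_def locally_lipschitz_continuous)

lemma h_nonzero: "(h1 t, h2 t) \<noteq> 0"
  using unit[of t] support_fun_scaleR[OF F, of 2 0] by force

text \<open>Although \<open>h\<close> is only differentiable almost everywhere, its cross product with a fixed value \<open>h s\<close>
  is differentiable at \<open>s\<close> for every \<open>s\<close>, since \<open>h \<bullet> u\<close> is constant.\<close>

lemma cross_has_real_derivative:
  "((\<lambda>t. h1 s * h2 t - h2 s * h1 t) has_real_derivative \<phi>3) (at s)"
proof -
  define f where "f = (\<lambda>t. h1 s * h2 t - h2 s * h1 t - \<phi>3 * t)"
  have "has_ae_derivative f (\<lambda>t. h1 s * (\<phi>3 * p t) - h2 s * (- \<phi>3 * q t) - \<phi>3 * 1)"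
    unfolding f_def
    by (rule has_ae_derivative_diff[OF has_ae_derivative_diff[OF has_ae_derivative_cmult[OF h_has_ae_derivative(2)]
        has_ae_derivative_cmult[OF h_has_ae_derivative(1)]] has_ae_derivative_cmult[OF has_ae_derivative_ident]])
  \<comment> \<open>Writing the subtracted \<phi>3 as
    \<open>\<phi>3 * (h1 t * p t + h2 t * q t)\<close> turns the derivative into a product of
    \<open>h s - h t\<close> with the bounded control, which is small near \<open>s\<close> by
    continuity of \<open>h\<close>.\<close>
  moreover have "AE t in lebesgue. h1 s * (\<phi>3 * p t) - h2 s * (- \<phi>3 * q t) - \<phi>3 * 1
      = \<phi>3 * ((h1 s - h1 t) * p t + (h2 s - h2 t) * q t)"
    using maximum
  proof eventually_elim
    case (elim t)
    have "\<phi>3 * 1 = \<phi>3 * (h1 t * p t + h2 t * q t)" by (simp only: elim)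
    then show ?case by (simp add: algebra_simps)
  qed
  ultimately have f: "has_ae_derivative f (\<lambda>t. \<phi>3 * ((h1 s - h1 t) * p t + (h2 s - h2 t) * q t))"
    by (rule has_ae_derivative_cong)
  have "(f has_derivative (\<lambda>h. 0)) (at s)"
    unfolding has_derivative_at_alt
  proof (intro conjI allI impI bounded_linear_zero)
    fix e :: real assume e: "e > 0"
    define \<eta> where "\<eta> = e / (2 * \<bar>\<phi>3\<bar> * B)"
    have \<eta>: "\<eta> > 0" "\<bar>\<phi>3\<bar> * (\<eta> * B + \<eta> * B) = e" using e B(1) \<phi>3 by (auto simp: \<eta>_def field_simps)
    obtain d1 where d1: "d1 > 0" "\<And>t. dist t s < d1 \<Longrightarrow> dist (h1 t) (h1 s) < \<eta>"
      using h_continuous(1)[of UNIV] \<eta>(1) unfolding continuous_on_iff by (metis UNIV_I)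
    obtain d2 where d2: "d2 > 0" "\<And>t. dist t s < d2 \<Longrightarrow> dist (h2 t) (h2 s) < \<eta>"
      using h_continuous(2)[of UNIV] \<eta>(1) unfolding continuous_on_iff by (metis UNIV_I)
    have "norm (f t - f s - 0) \<le> e * norm (t - s)" if t: "norm (t - s) < min d1 d2" for t
    proof -
      have "\<bar>\<phi>3 * ((h1 s - h1 r) * p r + (h2 s - h2 r) * q r)\<bar> \<le> e" if r: "r \<in> closed_segment s t" for r
      proof -
        have "dist r s < min d1 d2"
          using r t by (auto simp: closed_segment_eq_real_ivl dist_real_def split: if_splits)
        then have "\<bar>h1 s - h1 r\<bar> \<le> \<eta>" "\<bar>h2 s - h2 r\<bar> \<le> \<eta>"
          using d1(2)[of r] d2(2)[of r] by (auto simp: dist_real_def)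
        then have "\<bar>(h1 s - h1 r) * p r\<bar> \<le> \<eta> * B" "\<bar>(h2 s - h2 r) * q r\<bar> \<le> \<eta> * B"
          unfolding abs_mult using B \<eta>(1) by (intro mult_mono; simp)+
        then have "\<bar>(h1 s - h1 r) * p r + (h2 s - h2 r) * q r\<bar> \<le> \<eta> * B + \<eta> * B"
          by (rule order_trans[OF abs_triangle_ineq add_mono])
        then show ?thesis
          unfolding abs_mult \<eta>(2)[symmetric] by (rule mult_left_mono) simp
      qed
      then have "\<bar>f t - f s\<bar> \<le> e * \<bar>t - s\<bar>"
        using e by (intro has_ae_derivative_increment_bound[OF f]) auto
      then show ?thesis by simp
    qed
    then show "\<exists>d>0. \<forall>t. norm (t - s) < d \<longrightarrow> norm (f t - f s - 0) \<le> e * norm (t - s)"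
      using d1(1) d2(1) by (intro exI[of _ "min d1 d2"]) simp
  qed
  then have "(f has_real_derivative 0) (at s)"
    by (simp add: has_field_derivative_def lambda_zero[symmetric])
  from DERIV_add[OF this DERIV_cmult_Id[of \<phi>3 s]] show ?thesis
    by (simp add: f_def)
qed

text \<open>A nowhere vanishing continuous function on the line has a continuous logarithm. Its
  imaginary part serves as the angle, and \<open>unit\<close> forces the modulus to be the polar
  radius.\<close>

lemma polar_angle_exists: "\<exists>\<theta>. polar_angle F h1 h2 \<theta>"
proof -
  have "continuous_on UNIV (\<lambda>t. Complex (h1 t) (h2 t))"
    by (intro continuous_on_Complex h_continuous)
  moreover have "Complex (h1 t) (h2 t) \<noteq> 0" for t
    using h_nonzero[of t] by (simp add: complex_eq_iff zero_prod_def)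
  ultimately obtain l where l: "continuous_on UNIV l" "\<And>t. Complex (h1 t) (h2 t) = exp (l t)"
    using continuous_logarithm_on_contractible[of UNIV "\<lambda>t. Complex (h1 t) (h2 t)"] by auto
  define \<theta> where "\<theta> = (\<lambda>t. Im (l t))"
  have hl: "h1 t = exp (Re (l t)) * cos (\<theta> t)" "h2 t = exp (Re (l t)) * sin (\<theta> t)" for t
    using l(2)[of t] by (simp_all add: \<theta>_def complex_eq_iff Re_exp Im_exp)
  have "exp (Re (l t)) = polar_radius F (\<theta> t)" for t
    using unit[of t] support_fun_scaleR[OF F, of "exp (Re (l t))" "(cos (\<theta> t), sin (\<theta> t))"]
      support_fun_pos[OF F cos_sin_nonzero[OF F], of "\<theta> t"]
    by (simp add: hl polar_radius_eq[OF F] field_simps)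
  moreover have "continuous_on UNIV \<theta>"
    unfolding \<theta>_def by (intro continuous_intros l)
  ultimately show ?thesis
    unfolding polar_angle_def using hl by metis
qed

text \<open>The cross product of \<open>h s\<close> and \<open>h t\<close> is
  \<open>r s * r t * sin (\<theta> t - \<theta> s)\<close>; dividing by the continuous radii leaves
  the sine, which \<open>arcsin\<close> inverts near \<open>s\<close>.\<close>

lemma polar_angle_has_real_derivative:
  assumes \<theta>: "polar_angle F h1 h2 \<theta>"
  shows "(\<theta> has_real_derivative \<phi>3 / (polar_radius F (\<theta> s))\<^sup>2) (at s)"
proof -
  define r where "r = (\<lambda>t. polar_radius F (\<theta> t))"
  have \<theta>c: "continuous_on UNIV \<theta>" and h\<theta>: "\<And>t. h1 t = r t * cos (\<theta> t)" "\<And>t. h2 t = r t * sin (\<theta> t)"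
    using \<theta> by (simp_all add: polar_angle_def r_def)
  have r: "r t > 0" for t by (simp add: r_def polar_radius_pos[OF F])
  have rc: "isCont r t" for t
    using continuous_on_compose2[OF polar_radius_continuous[OF F] \<theta>c]
    by (simp add: r_def continuous_on_eq_continuous_at)
  \<comment> \<open>In Caratheodory's form of the derivative the factor \<open>g\<close> may be
    divided by \<open>r t\<close> although \<open>r\<close> is only known to be continuous.\<close>
  obtain g where g: "\<And>t. h1 s * h2 t - h2 s * h1 t = g t * (t - s)" "isCont g s" "g s = \<phi>3"
    using cross_has_real_derivative[of s] unfolding CARAT_DERIV by (auto simp: mult.commute)
  have "sin (\<theta> t - \<theta> s) = (g t / (r s * r t)) * (t - s)" for t
  proof -
    have "r s * r t * sin (\<theta> t - \<theta> s) = h1 s * h2 t - h2 s * h1 t"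
      by (simp add: h\<theta> sin_diff algebra_simps)
    also have "\<dots> = g t * (t - s)" by (rule g)
    finally show ?thesis
      using r[of s] r[of t] by (simp add: field_simps)
  qed
  moreover have "isCont (\<lambda>t. g t / (r s * r t)) s"
    using r[of s] by (intro continuous_intros g rc) simp
  ultimately have D: "((\<lambda>t. sin (\<theta> t - \<theta> s)) has_real_derivative \<phi>3 / (r s * r s)) (at s)"
    unfolding CARAT_DERIV using g(3) by (intro exI[of _ "\<lambda>t. g t / (r s * r t)"]) simp
  have "((\<lambda>t. arcsin (sin (\<theta> t - \<theta> s))) has_real_derivative
      inverse (sqrt (1 - (sin (\<theta> s - \<theta> s))\<^sup>2)) * (\<phi>3 / (r s * r s))) (at s)"
    by (rule DERIV_chain2[OF DERIV_arcsin D]) simp_all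
  then have "((\<lambda>t. arcsin (sin (\<theta> t - \<theta> s))) has_real_derivative \<phi>3 / (r s)\<^sup>2) (at s)"
    by (simp add: power2_eq_square)
  moreover have "\<forall>\<^sub>F t in nhds s. arcsin (sin (\<theta> t - \<theta> s)) = \<theta> t - \<theta> s"
  proof -
    have "isCont \<theta> s" using \<theta>c by (simp add: continuous_on_eq_continuous_at)
    then have "\<forall>\<^sub>F t in nhds s. dist (\<theta> t) (\<theta> s) < pi / 2"
      by (intro tendstoD) (simp_all add: isCont_def tendsto_at_iff_tendsto_nhds)
    then show ?thesis
      by eventually_elim (auto simp: dist_real_def abs_if intro!: arcsin_sin split: if_splits)
  qed
  ultimately have "((\<lambda>t. \<theta> t - \<theta> s) has_real_derivative \<phi>3 / (r s)\<^sup>2) (at s)"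
    using DERIV_cong_ev[OF refl _ refl] by fastforce
  from DERIV_add[OF this DERIV_const[of "\<theta> s"]] show ?thesis
    by (simp add: r_def)
qed

lemma polar_angle_time:
  assumes \<theta>: "polar_angle F h1 h2 \<theta>"
    and R: "\<And>\<eta>. (R has_real_derivative (polar_radius F \<eta>)\<^sup>2) (at \<eta>)"
  shows "R (\<theta> t) = R (\<theta> 0) + \<phi>3 * t"
proof -
  have "((\<lambda>t. R (\<theta> t) - \<phi>3 * t) has_real_derivative 0) (at t)" for t
  proof -
    have "((\<lambda>t. R (\<theta> t)) has_real_derivative (polar_radius F (\<theta> t))\<^sup>2 * (\<phi>3 / (polar_radius F (\<theta> t))\<^sup>2)) (at t)"
      by (rule DERIV_chain2[OF R polar_angle_has_real_derivative[OF \<theta>]])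
    then have "((\<lambda>t. R (\<theta> t)) has_real_derivative \<phi>3) (at t)"
      using polar_radius_pos[OF F, of "\<theta> t"] by simp
    from DERIV_diff[OF this DERIV_cmult_Id[of \<phi>3 t]] show ?thesis by simp
  qed
  then have "R (\<theta> t) - \<phi>3 * t = R (\<theta> 0) - \<phi>3 * 0"
    by (intro DERIV_isconst_all[of "\<lambda>t. R (\<theta> t) - \<phi>3 * t"] allI)
  then show ?thesis by simp
qed

text \<open>\<open>T\<close> is \<open>R\<close> shifted and divided by \<phi>3. Injectivity comes
  from strict monotonicity of \<open>R\<close>; surjectivity follows from
  \<open>T (\<theta> t) = t\<close>, without a study of \<open>R\<close> at infinity.\<close>

lemma polar_angle_inverse:
  assumes \<theta>: "polar_angle F h1 h2 \<theta>"
  defines "T \<equiv> \<lambda>\<eta>::real. LINT \<xi>=ereal (\<theta> 0)..ereal \<eta>|lebesgue. ((polar_radius F \<xi>)\<^sup>2 / \<phi>3)"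
  shows "bij T" "\<theta> = inv T"
proof -
  obtain R where R: "\<And>\<eta>. (R has_real_derivative (polar_radius F \<eta>)\<^sup>2) (at \<eta>)" "strict_mono R"
    by (rule polar_radius_antiderivative[OF F]) (rule that)
  have "has_ae_derivative (\<lambda>\<eta>. R \<eta> / \<phi>3) (\<lambda>\<eta>. (polar_radius F \<eta>)\<^sup>2 / \<phi>3)"
  proof (rule has_ae_derivative_C1)
    show "((\<lambda>\<eta>. R \<eta> / \<phi>3) has_real_derivative (polar_radius F \<eta>)\<^sup>2 / \<phi>3) (at \<eta>)" for \<eta>
      by (rule DERIV_cdivide[OF R(1)])
    show "continuous_on UNIV (\<lambda>\<eta>. (polar_radius F \<eta>)\<^sup>2 / \<phi>3)"
      using \<phi>3 by (intro continuous_intros polar_radius_continuous[OF F]) auto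
  qed
  then have T: "T \<eta> = R \<eta> / \<phi>3 - R (\<theta> 0) / \<phi>3" for \<eta>
    unfolding T_def by (rule interval_integral_ae_derivative)
  have T\<theta>: "T (\<theta> t) = t" for t
    unfolding T polar_angle_time[OF \<theta> R(1), of t] using \<phi>3 by (simp add: field_simps)
  have "inj T"
  proof (rule injI)
    fix a b assume "T a = T b"
    then have "R a = R b" using \<phi>3 by (simp add: T)
    then show "a = b" using strict_mono_eq[OF R(2)] by blast
  qed
  moreover have "surj T" using T\<theta> by (metis surjI)
  ultimately show bij: "bij T" by (simp add: bij_def)
  show "\<theta> = inv T"
  proof
    fix t
    show "\<theta> t = inv T t" using inv_f_f[OF \<open>inj T\<close>, of "\<theta> t"] T\<theta>[of t] by simp
  qed
qed

text \<open>\<open>R\<close> gains twice the area of the polar figure per turn, while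
  \<open>R (\<theta> t)\<close> grows at rate \<phi>3. The given time thus accounts for exactly one
  turn in the direction of the sign of \<phi>3.\<close>

lemma polar_angle_period:
  assumes \<theta>: "polar_angle F h1 h2 \<theta>"
  shows "\<theta> (t + 2 * measure lebesgue (polar_figure F) / \<bar>\<phi>3\<bar>) = \<theta> t + 2 * pi * sgn \<phi>3"
proof -
  let ?S = "measure lebesgue (polar_figure F)"
  obtain R where R: "\<And>\<eta>. (R has_real_derivative (polar_radius F \<eta>)\<^sup>2) (at \<eta>)"
    "\<And>\<eta>. R (\<eta> + 2 * pi) = R \<eta> + 2 * ?S" "strict_mono R"
    by (rule polar_radius_antiderivative[OF F]) (rule that)
  have "R (\<eta> + 2 * pi * sgn \<phi>3) = R \<eta> + 2 * ?S * sgn \<phi>3" for \<eta>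
    using R(2)[of \<eta>] R(2)[of "\<eta> - 2 * pi"] \<phi>3 by (simp add: sgn_if)
  then have "R (\<theta> t + 2 * pi * sgn \<phi>3) = R (\<theta> 0) + (\<phi>3 * t + 2 * ?S * sgn \<phi>3)"
    by (simp add: polar_angle_time[OF \<theta> R(1), of t])
  also have "\<phi>3 * t + 2 * ?S * sgn \<phi>3 = \<phi>3 * (t + 2 * ?S / \<bar>\<phi>3\<bar>)"
    using \<phi>3 by (simp add: sgn_if field_simps)
  also have "R (\<theta> 0) + \<dots> = R (\<theta> (t + 2 * ?S / \<bar>\<phi>3\<bar>))"
    by (rule polar_angle_time[OF \<theta> R(1), symmetric])
  finally show ?thesis using strict_mono_eq[OF R(3)] by metis
qed

lemma h_period:
  "h1 (t + 2 * measure lebesgue (polar_figure F) / \<bar>\<phi>3\<bar>) = h1 t"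
  "h2 (t + 2 * measure lebesgue (polar_figure F) / \<bar>\<phi>3\<bar>) = h2 t"
proof -
  obtain \<theta> where \<theta>: "polar_angle F h1 h2 \<theta>" using polar_angle_exists by blast
  have per: "\<theta> (t + 2 * measure lebesgue (polar_figure F) / \<bar>\<phi>3\<bar>) = \<theta> t + 2 * pi \<or>
      \<theta> (t + 2 * measure lebesgue (polar_figure F) / \<bar>\<phi>3\<bar>) + 2 * pi = \<theta> t"
    using polar_angle_period[OF \<theta>, of t] \<phi>3 by (auto simp: sgn_if)
  \<comment> \<open>For negative \<phi>3 this is used with the two times exchanged.\<close>
  have shift: "h1 s = h1 t \<and> h2 s = h2 t" if "\<theta> s = \<theta> t + 2 * pi" for s t
    using \<theta> that by (simp add: polar_angle_def polar_radius_periodic[OF F])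
  from per show "h1 (t + 2 * measure lebesgue (polar_figure F) / \<bar>\<phi>3\<bar>) = h1 t"
    "h2 (t + 2 * measure lebesgue (polar_figure F) / \<bar>\<phi>3\<bar>) = h2 t"
    using shift by metis+
qed

text \<open>Solving the formulas for \<open>h\<close> for the point \<open>(x t, y t)\<close> gives
  an affine map. Boundary points of the polar figure go to boundary points of its image.\<close>

lemma mem_rotated_polar_boundary:
  "\<exists>\<alpha>\<in>{pi/2, -pi/2}. \<forall>t. (x t, y t) \<in> rotated_polar_boundary F (1 / \<bar>\<phi>3\<bar>) \<alpha> (- \<phi>2 / \<phi>3, \<phi>1 / \<phi>3)"
proof -
  define f where "f = (\<lambda>(a, b). (- \<phi>2 / \<phi>3 + b / \<phi>3, \<phi>1 / \<phi>3 - a / \<phi>3))"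
  \<comment> \<open>The quarter turn absorbs the sign of \<phi>3, so that the scaling factor can be
    the positive number \<open>1 / \<bar>\<phi>3\<bar>\<close>.\<close>
  define \<alpha> where "\<alpha> = (if \<phi>3 > 0 then -pi/2 else pi/2)"
  have eq: "(\<lambda>p. (- \<phi>2 / \<phi>3, \<phi>1 / \<phi>3) + rotation \<alpha> ((1 / \<bar>\<phi>3\<bar>) *\<^sub>R p)) = f"
    using \<phi>3 by (auto simp: fun_eq_iff f_def \<alpha>_def rotation_def field_simps)
  have inj: "inj f" using \<phi>3 by (auto simp: inj_def f_def)
  have fh: "f (h1 t, h2 t) = (x t, y t)" for t
    using \<phi>3 by (simp add: f_def h field_simps)
  have fc: "continuous_on UNIV f"
    unfolding f_def case_prod_unfold using \<phi>3 by (intro continuous_intros) auto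
  have "(x t, y t) \<in> frontier (f ` polar_figure F)" for t
  proof -
    let ?h = "(h1 t, h2 t)"
    have "(x t, y t) \<in> f ` polar_figure F"
      by (rule image_eqI[of _ f ?h]) (simp_all add: fh polar_figure_def unit)
    then have "(x t, y t) \<in> closure (f ` polar_figure F)"
      by (rule subsetD[OF closure_subset])
    moreover have "(x t, y t) \<notin> interior (f ` polar_figure F)"
    proof
      assume int: "(x t, y t) \<in> interior (f ` polar_figure F)"
      \<comment> \<open>Pushing \<open>?h\<close> radially outwards raises the support function to
        \<open>1 + s\<close>, so points arbitrarily close to \<open>(x t, y t)\<close> lie outside
        the image.\<close>
      have "isCont (\<lambda>s. f ((1 + s) *\<^sub>R ?h)) 0"
        using continuous_on_compose2[OF fc, of UNIV "\<lambda>s. (1 + s) *\<^sub>R ?h"]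
        by (simp add: continuous_on_eq_continuous_at continuous_intros)
      then have "((\<lambda>s. f ((1 + s) *\<^sub>R ?h)) \<longlongrightarrow> (x t, y t)) (at_right 0)"
        using fh[of t] by (auto simp: isCont_def intro: tendsto_mono[OF at_le])
      from topological_tendstoD[OF this open_interior int]
      have "\<forall>\<^sub>F s in at_right 0. f ((1 + s) *\<^sub>R ?h) \<in> interior (f ` polar_figure F) \<and> s > 0"
        by (intro eventually_conj eventually_at_right_less)
      then obtain s where s: "s > 0" "f ((1 + s) *\<^sub>R ?h) \<in> interior (f ` polar_figure F)"
        using eventually_happens'[OF trivial_limit_at_right_real] by blast
      then have "(1 + s) *\<^sub>R ?h \<in> polar_figure F"
        using interior_subset inj by (metis inj_image_mem_iff subsetD)
      then show False
        using support_fun_scaleR[OF F, of "1 + s" ?h] unit[of t] s(1) by (simp add: polar_figure_def)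
    qed
    ultimately show ?thesis by (simp add: frontier_def)
  qed
  then have "\<forall>t. (x t, y t) \<in> rotated_polar_boundary F (1 / \<bar>\<phi>3\<bar>) \<alpha> (- \<phi>2 / \<phi>3, \<phi>1 / \<phi>3)"
    unfolding rotated_polar_boundary_def eq by blast
  moreover have "\<alpha> \<in> {pi/2, -pi/2}" by (simp add: \<alpha>_def)
  ultimately show ?thesis by (rule bexI)
qed

end

section \<open>Assembly on the Cartan group\<close>

lemma LINT_of_ae_derivative:
  assumes "has_ae_derivative f f'" "AE t in lebesgue. f' t = g t" "f 0 = 0"
  shows "(LINT \<tau>=0..ereal b|lebesgue. g \<tau>) = f b"
  using interval_integral_ae_derivative_cong[OF assms(1,2), of 0 b] assms(3) by (simp add: zero_ereal_def)

theorem proposition4: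
  fixes F :: "real \<times> real \<Rightarrow> real"
    and x y z v w h1 h2 :: "real \<Rightarrow> real"
    and u :: "real \<Rightarrow> real \<times> real"
    and \<psi> :: "real \<Rightarrow> real5"
    and \<phi>1 \<phi>2 \<phi>3 \<phi>4 \<phi>5 S0 L :: real
  assumes "quasinorm F"
    and "extremal F (\<lambda>t. (x t, y t, z t, v t, w t)) u \<psi>"
    and "x 0 = 0" "y 0 = 0" "z 0 = 0" "v 0 = 0" "w 0 = 0"
    and "\<psi> 0 = (\<phi>1, \<phi>2, \<phi>3, \<phi>4, \<phi>5)"
    and "\<phi>4 = 0" "\<phi>5 = 0" "\<phi>3 \<noteq> 0"
    and "\<And>t. h1 t = ham1 (\<psi> t) (x t, y t, z t, v t, w t)"
    and "\<And>t. h2 t = ham2 (\<psi> t) (x t, y t, z t, v t, w t)"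
    and "S0 = measure lebesgue (polar_figure F)"
    and "L = 2 * S0 / \<bar>\<phi>3\<bar>"
  shows
    "L > 0 \<and>
     (\<forall>t. h1 (t + L) = h1 t \<and> h2 (t + L) = h2 t \<and> x (t + L) = x t \<and> y (t + L) = y t) \<and>
     (\<forall>t. x t = (h2 t - \<phi>2) / \<phi>3 \<and> y t = - (h1 t - \<phi>1) / \<phi>3) \<and>
     (AE t in lebesgue. x differentiable (at t) \<and> y differentiable (at t) \<and>
        F (deriv x t, deriv y t) = 1) \<and>
     (\<exists>C. isoperimetrix F C \<and>
        (\<exists>\<alpha>\<in>{pi/2, -pi/2}.
           C = rotated_polar_boundary F (1 / \<bar>\<phi>3\<bar>) \<alpha> (- \<phi>2 / \<phi>3, \<phi>1 / \<phi>3)) \<and>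
        (\<forall>t. (x t, y t) \<in> C)) \<and>
     (\<exists>\<theta>. polar_angle F h1 h2 \<theta>) \<and>
     (\<forall>\<theta>. polar_angle F h1 h2 \<theta> \<longrightarrow>
        (\<forall>t. [\<theta> (t + L) = \<theta> t] (rmod (2 * pi))) \<and>
        (let T = (\<lambda>\<eta>::real. LINT \<xi>=\<theta> 0..\<eta>|lebesgue. ((polar_radius F \<xi>)\<^sup>2 / \<phi>3))
         in bij T \<and> \<theta> = inv T)) \<and>
     (\<forall>t. z t = (t - \<phi>1 * x t - \<phi>2 * y t) / (2 * \<phi>3) \<and>
        has_swept_area (\<lambda>\<tau>. (x \<tau>, y \<tau>)) 0 t (z t)) \<and>
     (\<forall>t. v t = 1/12 * (x t)\<^sup>2 * y t
              - 1/2 * x t * (LINT \<tau>=0..t|lebesgue. (x \<tau> * deriv y \<tau>))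
              + 1/2 * (LINT \<tau>=0..t|lebesgue. ((x \<tau>)\<^sup>2 * deriv y \<tau>))) \<and>
     (\<forall>t. w t = - 1/12 * x t * (y t)\<^sup>2
              - 1/2 * y t * (LINT \<tau>=0..t|lebesgue. (x \<tau> * deriv y \<tau>))
              + (LINT \<tau>=0..t|lebesgue. (x \<tau> * y \<tau> * deriv y \<tau>))) \<and>
     (\<forall>t. v t = 1/3 * (LINT \<tau>=0..t|lebesgue. (x \<tau> * deriv z \<tau> - z \<tau> * deriv x \<tau>))
              - 1/6 * x t * z t) \<and>
     (\<forall>t. w t = 1/3 * (LINT \<tau>=0..t|lebesgue. (y \<tau> * deriv z \<tau> - z \<tau> * deriv y \<tau>))
              - 1/6 * y t * z t)"
proof -
  let ?g = "\<lambda>t. (x t, y t, z t, v t, w t)"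
  define p q where pq: "p = (\<lambda>t. fst (u t))" "q = (\<lambda>t. snd (u t))"
  have tr: "trajectory F ?g u" using assms(2) by (simp add: extremal_def)
  have pq': "fst (u t) = p t" "snd (u t) = q t" for t by (simp_all add: pq)
  note ae = trajectory_has_ae_derivative[OF assms(1) tr, unfolded pq']
  obtain B where B: "B > 0" "\<And>t. \<bar>p t\<bar> \<le> B" "\<And>t. \<bar>q t\<bar> \<le> B"
    by (rule trajectory_control_bounded[OF assms(1) tr, unfolded pq']) (rule that)
  have \<psi>: "\<psi> t = (\<phi>1 - \<phi>3 / 2 * y t, \<phi>2 + \<phi>3 / 2 * x t, \<phi>3, 0, 0)" for t
    using extremal_covector[OF assms(1,2,3,4)] assms(8-10) by simp
  \<comment> \<open>Half of the slope \<phi>3 comes from the covector, the other half from the third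
    components of \<open>cartan_X\<close> and \<open>cartan_Y\<close>.\<close>
  have h: "h1 t = \<phi>1 - \<phi>3 * y t" "h2 t = \<phi>2 + \<phi>3 * x t" for t
    by (simp_all add: assms(12,13) \<psi> ham1_coords ham2_coords)
  have max: "AE t in lebesgue. h1 t * p t + h2 t * q t = 1 \<and> support_fun F (h1 t, h2 t) = 1"
  proof -
    have "AE t in lebesgue. hamiltonian (\<psi> t) (?g t) (u t) = support_fun F (ham1 (\<psi> t) (?g t), ham2 (\<psi> t) (?g t)) \<and>
        support_fun F (ham1 (\<psi> t) (?g t), ham2 (\<psi> t) (?g t)) = 1"
      using assms(2) by (simp add: extremal_def)
    then show ?thesis
      by eventually_elim (simp add: assms(12,13) hamiltonian_def pq)
  qed
  have xyc: "continuous_on UNIV x" "continuous_on UNIV y"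
    using ae(1,2) by (simp_all add: has_ae_derivative_def locally_lipschitz_continuous)
  have "continuous_on UNIV (\<lambda>t. support_fun F (h1 t, h2 t))"
    unfolding h by (intro continuous_on_compose2[OF support_fun_continuous[OF assms(1)]] continuous_intros xyc) auto
  moreover have "AE t in lebesgue. support_fun F (h1 t, h2 t) = 1"
    using max by eventually_elim simp
  ultimately have unit: "support_fun F (h1 t, h2 t) = 1" for t
    by (rule continuous_AE_eq_const)
  have max1: "AE t in lebesgue. h1 t * p t + h2 t * q t = 1"
    using max by eventually_elim simp
  interpret planar_extremal F x y h1 h2 p q \<phi>1 \<phi>2 \<phi>3 B
    by unfold_locales (use assms(1,11) ae B h unit max1 in auto)
  have L: "L = 2 * measure lebesgue (polar_figure F) / \<bar>\<phi>3\<bar>"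
    using assms(14,15) by simp
  have xy: "x t = (h2 t - \<phi>2) / \<phi>3" "y t = - (h1 t - \<phi>1) / \<phi>3" for t
    using \<phi>3 by (simp_all add: h)
  have dx: "AE t in lebesgue. deriv x t = p t" and dy: "AE t in lebesgue. deriv y t = q t"
    and dz: "AE t in lebesgue. deriv z t = - y t / 2 * p t + x t / 2 * q t"
    using has_ae_derivative_imp_AE_deriv[OF ae(1)] has_ae_derivative_imp_AE_deriv[OF ae(2)]
      has_ae_derivative_imp_AE_deriv[OF ae(3)] by (auto elim: eventually_mono)
  \<comment> \<open>That the polar figure has positive area is read off from the strict growth of
    \<open>R\<close> over one turn.\<close>
  have Lpos: "L > 0"
  proof -
    obtain R where R: "\<And>\<theta>. R (\<theta> + 2 * pi) = R \<theta> + 2 * measure lebesgue (polar_figure F)" "strict_mono R"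
      by (rule polar_radius_antiderivative[OF F]) (rule that)
    have "R 0 < R (0 + 2 * pi)" using R(2) by (rule strict_monoD) simp
    then show ?thesis using R(1)[of 0] \<phi>3 by (simp add: L)
  qed
  have periodic: "h1 (t + L) = h1 t" "h2 (t + L) = h2 t" for t
    using h_period by (simp_all add: L)
  have speed: "AE t in lebesgue. x differentiable (at t) \<and> y differentiable (at t) \<and> F (deriv x t, deriv y t) = 1"
    using has_ae_derivative_imp_AE_deriv[OF ae(1)] has_ae_derivative_imp_AE_deriv[OF ae(2)] max1
  proof eventually_elim
    case (elim t)
    have "F (p t, q t) \<le> 1"
      using tr by (auto simp: trajectory_def unit_figure_def pq)
    then have "F (p t, q t) = 1"
      using quasinorm_maximizer_eq_1[OF F, of "(p t, q t)" "(h1 t, h2 t)"] elim unit by simp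
    with elim show ?case by simp
  qed
  obtain \<alpha> where \<alpha>: "\<alpha> \<in> {pi/2, -pi/2}"
    "\<forall>t. (x t, y t) \<in> rotated_polar_boundary F (1 / \<bar>\<phi>3\<bar>) \<alpha> (- \<phi>2 / \<phi>3, \<phi>1 / \<phi>3)"
    using mem_rotated_polar_boundary by blast
  have "1 / \<bar>\<phi>3\<bar> > 0" using \<phi>3 by simp
  have iso: "\<exists>C. isoperimetrix F C \<and>
        (\<exists>\<alpha>\<in>{pi/2, -pi/2}. C = rotated_polar_boundary F (1 / \<bar>\<phi>3\<bar>) \<alpha> (- \<phi>2 / \<phi>3, \<phi>1 / \<phi>3)) \<and>
        (\<forall>t. (x t, y t) \<in> C)"
  proof (intro exI conjI)
    show "isoperimetrix F (rotated_polar_boundary F (1 / \<bar>\<phi>3\<bar>) \<alpha> (- \<phi>2 / \<phi>3, \<phi>1 / \<phi>3))"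
      unfolding isoperimetrix_def using \<alpha>(1) \<open>1 / \<bar>\<phi>3\<bar> > 0\<close> by blast
  qed (use \<alpha> in blast)+
  have angle: "(\<forall>t. [\<theta> (t + L) = \<theta> t] (rmod (2 * pi))) \<and>
        (let T = (\<lambda>\<eta>::real. LINT \<xi>=\<theta> 0..\<eta>|lebesgue. ((polar_radius F \<xi>)\<^sup>2 / \<phi>3))
         in bij T \<and> \<theta> = inv T)" if \<theta>: "polar_angle F h1 h2 \<theta>" for \<theta>
  proof
    show "\<forall>t. [\<theta> (t + L) = \<theta> t] (rmod (2 * pi))"
    proof
      fix t
      have "\<theta> (t + L) = \<theta> t + of_int (if \<phi>3 > 0 then 1 else -1) * (2 * pi)"
        using polar_angle_period[OF \<theta>, of t] \<phi>3 by (simp add: L sgn_if)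
      then show "[\<theta> (t + L) = \<theta> t] (rmod (2 * pi))"
        using rcong_add[OF rcong_refl[of "\<theta> t"] rcong_sym[OF rcong_mult_of_int_0_left_left]] by (metis add.right_neutral)
    qed
    show "let T = (\<lambda>\<eta>::real. LINT \<xi>=\<theta> 0..\<eta>|lebesgue. ((polar_radius F \<xi>)\<^sup>2 / \<phi>3)) in bij T \<and> \<theta> = inv T"
      unfolding Let_def using polar_angle_inverse[OF \<theta>] by blast
  qed
  have zt: "z t = (t - \<phi>1 * x t - \<phi>2 * y t) / (2 * \<phi>3)" for t
  proof -
    have "has_ae_derivative (\<lambda>t. (1 / (2 * \<phi>3)) * (t - \<phi>1 * x t - \<phi>2 * y t)) (\<lambda>t. (1 / (2 * \<phi>3)) * (1 - \<phi>1 * p t - \<phi>2 * q t))"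
      by (intro has_ae_derivative_cmult has_ae_derivative_diff has_ae_derivative_ident ae)
    moreover have "AE t in lebesgue. (1 / (2 * \<phi>3)) * (1 - \<phi>1 * p t - \<phi>2 * q t) = (- y t / 2) * p t + (x t / 2) * q t"
      using max1
    proof eventually_elim
      case (elim t)
      \<comment> \<open>This is \<open>h \<bullet> u = 1\<close> with \<open>h\<close> expressed
        through \<open>x\<close> and \<open>y\<close>; the right-hand side is
        \<open>2 * \<phi>3\<close> times the derivative of \<open>z\<close>.\<close>
      have "1 - \<phi>1 * p t - \<phi>2 * q t = \<phi>3 * (x t * q t - y t * p t)"
        unfolding elim[symmetric] by (simp add: h algebra_simps)
      then show ?case using \<phi>3 by (simp add: field_simps)
    qed
    ultimately have "has_ae_derivative (\<lambda>t. (1 / (2 * \<phi>3)) * (t - \<phi>1 * x t - \<phi>2 * y t))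
        (\<lambda>t. (- y t / 2) * p t + (x t / 2) * q t)"
      by (rule has_ae_derivative_cong)
    from has_ae_derivative_unique[OF ae(3) this] show ?thesis
      using assms(3,4,5) by simp
  qed
  have area: "has_swept_area (\<lambda>\<tau>. (x \<tau>, y \<tau>)) 0 t (z t)" for t
    using has_swept_area_of_ae_derivative[OF ae(1,2) B(2,3) ae(3), of 0 t] assms(5) by simp
  \<comment> \<open>Half the derivative of \<open>x * y\<close>, added to that of \<open>z\<close>,
    leaves \<open>x\<close> times the derivative of \<open>y\<close>.\<close>
  define P where "P = (\<lambda>t. z t + 1/2 * (x t * y t))"
  note P = has_ae_derivative_add[OF ae(3) has_ae_derivative_cmult[OF has_ae_derivative_mult[OF ae(1,2)], of "1/2"], folded P_def]
  have I1: "(LINT \<tau>=0..ereal t|lebesgue. (x \<tau> * deriv y \<tau>)) = P t" for t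
  proof (rule LINT_of_ae_derivative[OF P])
    show "AE t in lebesgue. - y t / 2 * p t + x t / 2 * q t + 1/2 * (p t * y t + q t * x t) = x t * deriv y t"
      using dy by eventually_elim (simp add: field_simps)
  qed (simp add: P_def assms)
  have xx: "has_ae_derivative (\<lambda>t. x t * x t) (\<lambda>t. p t * x t + p t * x t)"
    by (rule has_ae_derivative_mult[OF ae(1) ae(1)])
  have yy: "has_ae_derivative (\<lambda>t. y t * y t) (\<lambda>t. q t * y t + q t * y t)"
    by (rule has_ae_derivative_mult[OF ae(2) ae(2)])
  \<comment> \<open>The antiderivative is the asserted formula for \<open>v\<close> solved for its
    last integral; \<open>W\<close>, \<open>V'\<close> and \<open>W'\<close> arise likewise from the
    other three formulas.\<close>
  note Q = has_ae_derivative_add[OF has_ae_derivative_diff[OF has_ae_derivative_cmult[OF ae(4), of 2]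
      has_ae_derivative_cmult[OF has_ae_derivative_mult[OF xx ae(2)], of "1/6"]] has_ae_derivative_mult[OF ae(1) P]]
  have I2: "(LINT \<tau>=0..ereal t|lebesgue. ((x \<tau>)\<^sup>2 * deriv y \<tau>)) = 2 * v t - 1/6 * (x t * x t * y t) + x t * P t" for t
    by (rule LINT_of_ae_derivative[OF Q], use dy in eventually_elim)
      (simp_all add: P_def assms(3-7) field_simps power2_eq_square)
  note W = has_ae_derivative_add[OF has_ae_derivative_add[OF ae(5)
      has_ae_derivative_cmult[OF has_ae_derivative_mult[OF ae(1) yy], of "1/12"]]
      has_ae_derivative_cmult[OF has_ae_derivative_mult[OF ae(2) P], of "1/2"]]
  have I3: "(LINT \<tau>=0..ereal t|lebesgue. (x \<tau> * y \<tau> * deriv y \<tau>)) = w t + 1/12 * (x t * (y t * y t)) + 1/2 * (y t * P t)" for t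
    by (rule LINT_of_ae_derivative[OF W], use dy in eventually_elim)
      (simp_all add: P_def assms(3-7) field_simps power2_eq_square)
  note V' = has_ae_derivative_add[OF has_ae_derivative_cmult[OF ae(4), of 3]
      has_ae_derivative_cmult[OF has_ae_derivative_mult[OF ae(1) ae(3)], of "1/2"]]
  have I4: "(LINT \<tau>=0..ereal t|lebesgue. (x \<tau> * deriv z \<tau> - z \<tau> * deriv x \<tau>)) = 3 * v t + 1/2 * (x t * z t)" for t
    by (rule LINT_of_ae_derivative[OF V'], use dx dz in eventually_elim, simp only:)
      (simp_all add: assms(3-7) field_simps power2_eq_square)
  note W' = has_ae_derivative_add[OF has_ae_derivative_cmult[OF ae(5), of 3]
      has_ae_derivative_cmult[OF has_ae_derivative_mult[OF ae(2) ae(3)], of "1/2"]]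
  have I5: "(LINT \<tau>=0..ereal t|lebesgue. (y \<tau> * deriv z \<tau> - z \<tau> * deriv y \<tau>)) = 3 * w t + 1/2 * (y t * z t)" for t
    by (rule LINT_of_ae_derivative[OF W'], use dy dz in eventually_elim, simp only:)
      (simp_all add: assms(3-7) field_simps power2_eq_square)
  show ?thesis
  proof (intro conjI allI impI)
    show "L > 0" by (rule Lpos)
    show "h1 (t + L) = h1 t" "h2 (t + L) = h2 t" for t by (fact periodic)+
    show "x (t + L) = x t" "y (t + L) = y t" for t by (simp_all add: xy periodic)
    show "x t = (h2 t - \<phi>2) / \<phi>3" "y t = - (h1 t - \<phi>1) / \<phi>3" for t by (fact xy)+
    show "\<exists>\<theta>. polar_angle F h1 h2 \<theta>" by (rule polar_angle_exists)
    show "AE t in lebesgue. x differentiable (at t) \<and> y differentiable (at t) \<and> F (deriv x t, deriv y t) = 1"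
      by (rule speed)
    show "z t = (t - \<phi>1 * x t - \<phi>2 * y t) / (2 * \<phi>3)" for t by (rule zt)
    show "has_swept_area (\<lambda>\<tau>. (x \<tau>, y \<tau>)) 0 t (z t)" for t by (rule area)
    show "v t = 1/12 * (x t)\<^sup>2 * y t
        - 1/2 * x t * (LINT \<tau>=0..ereal t|lebesgue. (x \<tau> * deriv y \<tau>))
        + 1/2 * (LINT \<tau>=0..ereal t|lebesgue. ((x \<tau>)\<^sup>2 * deriv y \<tau>))" for t
      unfolding I1 I2 by (simp add: field_simps power2_eq_square)
    show "w t = - 1/12 * x t * (y t)\<^sup>2
        - 1/2 * y t * (LINT \<tau>=0..ereal t|lebesgue. (x \<tau> * deriv y \<tau>))
        + (LINT \<tau>=0..ereal t|lebesgue. (x \<tau> * y \<tau> * deriv y \<tau>))" for t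
      unfolding I1 I3 by (simp add: field_simps power2_eq_square)
    show "v t = 1/3 * (LINT \<tau>=0..ereal t|lebesgue. (x \<tau> * deriv z \<tau> - z \<tau> * deriv x \<tau>))
        - 1/6 * x t * z t" for t
      unfolding I4 by (simp add: field_simps)
    show "w t = 1/3 * (LINT \<tau>=0..ereal t|lebesgue. (y \<tau> * deriv z \<tau> - z \<tau> * deriv y \<tau>))
        - 1/6 * y t * z t" for t
      unfolding I5 by (simp add: field_simps)
  qed (use iso angle in blast)+
qed

end
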